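(* Let $M\ge2$, let $q\in\mathbb C^\times$ not be a root of unity (with a chosen logarithm), and let $U$ be a finite dimensional $U_q\mathfrak{sl}_M$-module of type I. For $1\le i\le M-1$, a weight $\mu$ of $U$, and $\lambda\in\mathfrak h^*=\mathbb C^M/\mathbb C(1,\dots,1)$, $$A_{i,U}(q^{2\lambda})|_{U[\mu]}=\begin{cases}q^{-\mu(h_i)}\mathscr A_{s_i,U}(\lambda),&\text{if }\mu(h_i)\ge0,\\[4pt] (-1)^{\mu(h_i)}q^{-\mu(h_i)}\dfrac{[\lambda(h_i)-\mu(h_i)/2]_q}{[\lambda(h_i)+\mu(h_i)/2]_q}\,\mathscr A_{s_i,U}(\lambda),&\text{if }\mu(h_i)\le0,\end{cases}$$ as meromorphic functions of $\lambda$, where on the right-hand side $\mathscr A_{s_i,U}(\lambda)$ is restricted to $U[\mu]$.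
   Context: For $x\in\mathbb C$, $[x]_q=\frac{q^x-q^{-x}}{q-q^{-1}}$; $[n]_q!=\prod_{j=1}^n[j]_q$; $(x)_+=\max(x,0)$. $\mathfrak h=\{x\in\mathbb C^M:\sum x_i=0\}$, $h_i=(0,\dots,0,1,-1,0,\dots,0)$ (with $1$ in position $i$), $\lambda(h_i)=\lambda_i-\lambda_{i+1}$. $U_q\mathfrak{sl}_M$ has generators $E_i,F_i,K_i^{\pm1}$ ($1\le i\le M-1$) with $[E_i,F_j]=\delta_{ij}\frac{K_i-K_i^{-1}}{q-q^{-1}}$, $K_iE_jK_i^{-1}=q^{a_{ij}}E_j$, $K_iF_jK_i^{-1}=q^{-a_{ij}}F_j$ and the $q$-Serre relations ($a_{ij}$ the Cartan matrix of type $A_{M-1}$). Type I: $U=\oplus_\mu U[\mu]$ with $\mu\in\mathbb Z^M/\mathbb Z(1,\dots,1)$, $K_i$ acting on $U[\mu]$ by $q^{\mu(h_i)}$. Divided powers: $E_i^{(l)}=E_i^l/[l]_q!$, $F_i^{(l)}=F_i^l/[l]_q!$. $A_{i,U}(z)$ is the $\operatorname{End}(U)$-valued rational function of $z=(z_1,\dots,z_M)$, depending only on ratios of the $z_j$, given on $U[\mu]$ by $$A_{i,U}(z)|_{U[\mu]}=\sum_{j\ge0}(-q)^j\frac{z_{i+1}-q^{|\mu(h_i)|}z_i}{z_{i+1}-q^{2j+|\mu(h_i)|}z_i}E_i^{(j+(-\mu(h_i))_+)}F_i^{(j+(\mu(h_i))_+)}.$$ $A_{i,U}(q^{2\lambda})$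 is its value at $z=(q^{2\lambda_1},\dots,q^{2\lambda_M})$. $\mathscr A_{s_i,U}(\lambda)$ is the operator of the Etingof--Varchenko dynamical Weyl group for the simple reflection $s_i$. It is determined explicitly as follows: it is a meromorphic function of $\lambda(h_i)$ with values in $\operatorname{End}(U)$, and if $v_\ell\in U$ is a weight vector with $E_iv_\ell=0$, $K_iv_\ell=q^\ell v_\ell$ ($\ell\in\mathbb Z_{\ge0}$), and $v_{\ell-2k}=F_i^{(k)}v_\ell$ for $0\le k\le\ell$, then $$\mathscr A_{s_i,U}(\lambda)v_m=(-1)^kq^m\prod_{j=1}^k\frac{[\lambda(h_i)+k-j-\ell/2]_q}{[\lambda(h_i)-k+j+\ell/2]_q}\,v_{-m},\qquad m=\ell-2k.$$ *)

theory Defs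
  imports
    "HOL-Complex_Analysis.Complex_Analysis"
    "HOL-Library.Groups_Big_Fun"
begin

text \<open>
  Throughout, \<open>\<tau>\<close> is the chosen logarithm of \<open>q\<close>, i.e. \<open>q = exp \<tau>\<close>, and \<open>q\<^sup>x = exp (\<tau> x)\<close> for
  complex \<open>x\<close>.
\<close>

definition qpow :: "complex \<Rightarrow> complex \<Rightarrow> complex" where
  "qpow \<tau> x = exp (\<tau> * x)"

definition qnum :: "complex \<Rightarrow> complex \<Rightarrow> complex" where
  "qnum \<tau> x = (qpow \<tau> x - qpow \<tau> (- x)) / (qpow \<tau> 1 - qpow \<tau> (- 1))"

definition qfact :: "complex \<Rightarrow> nat \<Rightarrow> complex" where
  "qfact \<tau> n = (\<Prod>j=1..n. qnum \<tau> (of_nat j))"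

text \<open>
  Elements of \<open>\<int>\<^sup>M / \<int>(1,\<dots>,1)\<close> and of \<open>\<complex>\<^sup>M / \<complex>(1,\<dots>,1)\<close> are given by representatives, that is by
  functions on \<open>nat\<close> of which only the values at \<open>1, \<dots>, M\<close> matter. They enter only through the
  pairings \<open>\<nu>(h\<^sub>i) = \<nu>\<^sub>i - \<nu>\<^sub>i\<^sub>+\<^sub>1\<close>, or through ratios of the numbers \<open>q\<^bsup>2\<lambda>\<^sub>j\<^esup>\<close>, which do not depend on
  the representative.
\<close>

definition hpair :: "(nat \<Rightarrow> 'a::minus) \<Rightarrow> nat \<Rightarrow> 'a" where
  "hpair \<nu> i = \<nu> i - \<nu> (Suc i)"

definition cartanA :: "nat \<Rightarrow> nat \<Rightarrow> int" where
  "cartanA i j = (if i = j then 2 else if i = Suc j \<or> j = Suc i then -1 else 0)"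

text \<open>The underlying vector space is the whole type \<open>'u\<close>, with scalar multiplication \<open>smult\<close>.\<close>

record 'u Uq_rep =
  smult :: "complex \<Rightarrow> 'u \<Rightarrow> 'u"
  opE :: "nat \<Rightarrow> 'u \<Rightarrow> 'u"
  opF :: "nat \<Rightarrow> 'u \<Rightarrow> 'u"
  opK :: "nat \<Rightarrow> 'u \<Rightarrow> 'u"
  opKinv :: "nat \<Rightarrow> 'u \<Rightarrow> 'u"

definition is_endo :: "('u::ab_group_add) Uq_rep \<Rightarrow> ('u \<Rightarrow> 'u) \<Rightarrow> bool" where
  "is_endo U T \<longleftrightarrow> Vector_Spaces.linear (smult U) (smult U) T"

definition is_functional :: "('u::ab_group_add) Uq_rep \<Rightarrow> ('u \<Rightarrow> complex) \<Rightarrow> bool" where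
  "is_functional U \<phi> \<longleftrightarrow> Vector_Spaces.linear (smult U) (*) \<phi>"

text \<open>
  A module over \<open>U\<^sub>q sl\<^sub>M\<close>, an algebra presented by generators and relations, is a vector space with
  operators satisfying these relations.
\<close>

locale Uq_sl_module =
  fixes q :: complex and M :: nat and U :: "('u::ab_group_add) Uq_rep"
  assumes vector_space: "vector_space (smult U)"
    and endo: "\<And>i. i \<in> {1..<M} \<Longrightarrow>
      is_endo U (opE U i) \<and> is_endo U (opF U i) \<and> is_endo U (opK U i) \<and> is_endo U (opKinv U i)"
    and K_inverse: "\<And>i u. i \<in> {1..<M} \<Longrightarrow>
      opK U i (opKinv U i u) = u \<and> opKinv U i (opK U i u) = u"
    and K_commute: "\<And>i j u. i \<in> {1..<M} \<Longrightarrow> j \<in> {1..<M} \<Longrightarrow>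
      opK U i (opK U j u) = opK U j (opK U i u)"
    and K_E: "\<And>i j u. i \<in> {1..<M} \<Longrightarrow> j \<in> {1..<M} \<Longrightarrow>
      opK U i (opE U j (opKinv U i u)) = smult U (q powi cartanA i j) (opE U j u)"
    and K_F: "\<And>i j u. i \<in> {1..<M} \<Longrightarrow> j \<in> {1..<M} \<Longrightarrow>
      opK U i (opF U j (opKinv U i u)) = smult U (q powi (- cartanA i j)) (opF U j u)"
    and E_F: "\<And>i j u. i \<in> {1..<M} \<Longrightarrow> j \<in> {1..<M} \<Longrightarrow>
      opE U i (opF U j u) - opF U j (opE U i u) =
        (if i = j then smult U (1 / (q - inverse q)) (opK U i u - opKinv U i u) else 0)"
    and Serre_E_far: "\<And>i j u. i \<in> {1..<M} \<Longrightarrow> j \<in> {1..<M} \<Longrightarrow> cartanA i j = 0 \<Longrightarrow>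
      opE U i (opE U j u) = opE U j (opE U i u)"
    and Serre_F_far: "\<And>i j u. i \<in> {1..<M} \<Longrightarrow> j \<in> {1..<M} \<Longrightarrow> cartanA i j = 0 \<Longrightarrow>
      opF U i (opF U j u) = opF U j (opF U i u)"
    and Serre_E_near: "\<And>i j u. i \<in> {1..<M} \<Longrightarrow> j \<in> {1..<M} \<Longrightarrow> cartanA i j = -1 \<Longrightarrow>
      opE U i (opE U i (opE U j u)) - smult U (q + inverse q) (opE U i (opE U j (opE U i u)))
        + opE U j (opE U i (opE U i u)) = 0"
    and Serre_F_near: "\<And>i j u. i \<in> {1..<M} \<Longrightarrow> j \<in> {1..<M} \<Longrightarrow> cartanA i j = -1 \<Longrightarrow>
      opF U i (opF U i (opF U j u)) - smult U (q + inverse q) (opF U i (opF U j (opF U i u)))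
        + opF U j (opF U i (opF U i u)) = 0"

definition finite_dim_rep :: "('u::ab_group_add) Uq_rep \<Rightarrow> bool" where
  "finite_dim_rep U \<longleftrightarrow> (\<exists>B. finite B \<and> module.span (smult U) B = UNIV)"

definition wt_space :: "complex \<Rightarrow> nat \<Rightarrow> ('u::ab_group_add) Uq_rep \<Rightarrow> (nat \<Rightarrow> int) \<Rightarrow> 'u set" where
  "wt_space q M U \<mu> = {u. \<forall>i\<in>{1..<M}. opK U i u = smult U (q powi hpair \<mu> i) u}"

definition is_weight :: "complex \<Rightarrow> nat \<Rightarrow> ('u::ab_group_add) Uq_rep \<Rightarrow> (nat \<Rightarrow> int) \<Rightarrow> bool" where
  "is_weight q M U \<mu> \<longleftrightarrow> wt_space q M U \<mu> \<noteq> {0}"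

text \<open>
  \<open>U\<close> is the sum of its weight spaces. The sum over \<open>\<int>\<^sup>M / \<int>(1,\<dots>,1)\<close> is automatically direct: as \<open>q\<close> is
  not a root of unity, distinct classes give distinct systems of eigenvalues of the \<open>K\<^sub>i\<close>.
\<close>

definition type_I :: "complex \<Rightarrow> nat \<Rightarrow> ('u::ab_group_add) Uq_rep \<Rightarrow> bool" where
  "type_I q M U \<longleftrightarrow> module.span (smult U) (\<Union>\<mu>. wt_space q M U \<mu>) = UNIV"

definition divE :: "complex \<Rightarrow> ('u::ab_group_add) Uq_rep \<Rightarrow> nat \<Rightarrow> nat \<Rightarrow> 'u \<Rightarrow> 'u" where
  "divE \<tau> U i l u = smult U (1 / qfact \<tau> l) ((opE U i ^^ l) u)"

definition divF :: "complex \<Rightarrow> ('u::ab_group_add) Uq_rep \<Rightarrow> nat \<Rightarrow> nat \<Rightarrow> 'u \<Rightarrow> 'u" where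
  "divF \<tau> U i l u = smult U (1 / qfact \<tau> l) ((opF U i ^^ l) u)"

text \<open>
  The series defining \<open>A\<^sub>i\<^sub>,\<^sub>U(z)\<close> on a vector of weight \<open>\<mu>\<close>, with \<open>m = \<mu>(h\<^sub>i)\<close>; \<open>nat m\<close> is the positive
  part of \<open>m\<close>. \<open>F\<^sub>i\<close> is nilpotent on a finite dimensional module of type I, so only finitely many
  terms are nonzero, and \<^const>\<open>Sum_any\<close> sums these. Where a denominator vanishes the rational
  function is not defined and the value given by division by zero is meaningless.
\<close>

definition A_series ::
  "complex \<Rightarrow> ('u::ab_group_add) Uq_rep \<Rightarrow> nat \<Rightarrow> (nat \<Rightarrow> complex) \<Rightarrow> int \<Rightarrow> 'u \<Rightarrow> 'u" where
  "A_series \<tau> U i z m u = (let q = exp \<tau> in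
     Sum_any (\<lambda>j::nat.
       smult U ((- q) ^ j * ((z (Suc i) - q powi \<bar>m\<bar> * z i) /
                             (z (Suc i) - q powi (2 * int j + \<bar>m\<bar>) * z i)))
         (divE \<tau> U i (j + nat (- m)) (divF \<tau> U i (j + nat m) u))))"

definition A_op ::
  "complex \<Rightarrow> nat \<Rightarrow> ('u::ab_group_add) Uq_rep \<Rightarrow> nat \<Rightarrow> (nat \<Rightarrow> complex) \<Rightarrow> 'u \<Rightarrow> 'u" where
  "A_op \<tau> M U i z = (THE T. is_endo U T \<and>
     (\<forall>\<mu>. \<forall>u \<in> wt_space (exp \<tau>) M U \<mu>. T u = A_series \<tau> U i z (hpair \<mu> i) u))"

text \<open>
  The operator of the dynamical Weyl group for \<open>s\<^sub>i\<close>: the endomorphism determined by its values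
  \<open>v\<^sub>m \<mapsto> \<dots> v\<^sub>-\<^sub>m\<close>, \<open>m = l - 2 k\<close>, on all strings \<open>v\<^bsub>l-2k\<^esub> = F\<^sub>i\<^bsup>(k)\<^esup> v\<^sub>l\<close>, where \<open>v\<^sub>-\<^sub>m = F\<^sub>i\<^bsup>(l-k)\<^esup> v\<^sub>l\<close>. As for \<open>A_series\<close>,
  values at the poles are meaningless. That \<open>lam \<mapsto> dyn_weyl\<close> is a meromorphic function of \<open>\<lambda>(h\<^sub>i)\<close>
  is not part of the definition but follows from it.
\<close>

definition dyn_weyl ::
  "complex \<Rightarrow> nat \<Rightarrow> ('u::ab_group_add) Uq_rep \<Rightarrow> nat \<Rightarrow> (nat \<Rightarrow> complex) \<Rightarrow> 'u \<Rightarrow> 'u" where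
  "dyn_weyl \<tau> M U i lam = (THE T. is_endo U T \<and>
     (\<forall>\<nu> l k v. v \<in> wt_space (exp \<tau>) M U \<nu> \<longrightarrow> opE U i v = 0 \<longrightarrow>
        opK U i v = smult U (exp \<tau> ^ l) v \<longrightarrow> k \<le> l \<longrightarrow>
        T (divF \<tau> U i k v) =
          smult U ((-1) ^ k * exp \<tau> powi (int l - 2 * int k) *
                   (\<Prod>j=1..k. qnum \<tau> (hpair lam i + of_nat k - of_nat j - of_nat l / 2) /
                              qnum \<tau> (hpair lam i - of_nat k + of_nat j + of_nat l / 2)))
                (divF \<tau> U i (l - k) v)))"

text \<open>
  \<open>\<Phi>\<close> and \<open>\<Psi>\<close> restrict on \<open>S\<close> to the same meromorphic function \<open>\<lambda> \<mapsto> H (\<lambda>(h\<^sub>i))\<close>: \<open>H\<close> is meromorphic in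
  one complex variable (coefficientwise, i.e. after applying any linear functional), and \<open>\<Phi>\<close>, \<open>\<Psi>\<close>
  agree with it for all \<open>\<lambda>\<close> outside the locally finite union of hyperplanes \<open>\<lambda>(h\<^sub>i) = x\<close>, with \<open>x\<close> in a
  sparse exceptional set.
\<close>

definition meromorphic_eq_on ::
  "('u::ab_group_add) Uq_rep \<Rightarrow> nat \<Rightarrow> 'u set \<Rightarrow>
     ((nat \<Rightarrow> complex) \<Rightarrow> 'u \<Rightarrow> 'u) \<Rightarrow> ((nat \<Rightarrow> complex) \<Rightarrow> 'u \<Rightarrow> 'u) \<Rightarrow> bool" where
  "meromorphic_eq_on U i S \<Phi> \<Psi> \<longleftrightarrow> (\<exists>H :: complex \<Rightarrow> 'u \<Rightarrow> 'u.
     (\<forall>u\<in>S. \<forall>\<phi>. is_functional U \<phi> \<longrightarrow> (\<lambda>x. \<phi> (H x u)) meromorphic_on UNIV) \<and>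
     (\<forall>\<^sub>\<approx>x. \<forall>lam. hpair lam i = x \<longrightarrow> (\<forall>u\<in>S. \<Phi> lam u = H x u \<and> \<Psi> lam u = H x u)))"

end

theory Submission
  imports Defs
begin

text \<open>
  The operators \<open>E = E\<^sub>i\<close>, \<open>F = F\<^sub>i\<close>, \<open>K = K\<^sub>i\<close> make \<open>U\<close> a representation of quantum \<open>sl\<^sub>2\<close>, and \<open>U\<close> is
  spanned by the vectors \<open>v\<^sub>m = F\<^bsup>(k)\<^esup> v\<close>, \<open>m = l - 2 k\<close>, of its strings, where \<open>v\<close> is a highest weight
  vector of weight \<open>l \<ge> k\<close>. Each of the two operators sends \<open>v\<^sub>m\<close> to a multiple of
  \<open>v\<^sub>-\<^sub>m = F\<^bsup>(l-k)\<^esup> v\<close>, so the proposition amounts to an identity between two scalar functions of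
  \<open>x = \<lambda>(h\<^sub>i)\<close>, together with the fact that both operators are determined by their values on such vectors.

  The scalar identity. Put \<open>p = |m|\<close>, \<open>\<kappa> = min k (l - k)\<close>, \<open>t = q\<^bsup>-2x\<^esup>\<close> and \<open>a\<^sub>j = q\<^bsup>p+2j\<^esup>\<close>. Moving the
  divided powers through the string (\<open>divided_powers_on_string\<close>) turns the coefficient of the series
  into \<open>\<Sum>j\<le>\<kappa>. (- q)\<^bsup>j\<^esup> (t - a\<^sub>0) / (t - a\<^sub>j) c\<^sub>j\<close> with \<open>c\<^sub>j\<close> a quotient of \<open>q\<close>-factorials. After division by
  \<open>t - a\<^sub>0\<close> this is the partial fraction expansion of
  \<open>\<Prod>r=1..\<kappa>. (1 - a\<^sub>r t) / \<Prod>r=0..\<kappa>. (t - a\<^sub>r)\<close>, whose numerator has smaller degree than its denominator;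
  the residues are computed in \<open>dynamical_sum\<close>. For \<open>m \<ge> 0\<close> the resulting product is the coefficient of
  the dynamical Weyl group up to the factor \<open>q\<^bsup>m\<^esup>\<close>. For \<open>m < 0\<close> the latter has \<open>k > \<kappa>\<close> factors; the extra
  quotient in the proposition is what makes the superfluous ones cancel (\<open>string_factor_reflect\<close>).

  Existence and uniqueness of the operators. The strings span \<open>U\<close> (\<open>span_strings\<close>): vectors of
  nonnegative weight are handled by peeling off highest weight vectors, and a vector of negative weight
  lies in the image of \<open>F\<close>, which follows from the same peeling with \<open>E\<close> and \<open>F\<close> exchanged. So
  at most one operator has the prescribed values. For existence, prescribed linear maps on the
  eigenspaces of \<open>K\<close> are glued by means of the spectral projections of \<open>K\<close>, which are polynomials in
  \<open>K\<close> (\<open>glue_endomorphisms\<close>). The dynamical Weyl group operator is then obtained by rescaling the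
  series on every eigenspace, and the scalar identity says precisely that this has the required values
  on strings. The rescaling requires \<open>x\<close> to avoid the zeros of \<open>[x + r/2]\<close> with \<open>r\<close> an integer bounded by the weights of \<open>U\<close>.
  As there are only finitely many weights, these zeros form a sparse set; without a bound on \<open>r\<close>
  they would accumulate, for instance if \<open>|q| = 1\<close>.
\<close>

section \<open>Partial fractions\<close>

text \<open>
  The numerator is recovered from its values at the poles by interpolation, since its degree is smaller
  than the number of poles.
\<close>

lemma lagrange_interpolation:
  fixes f :: "'a::field poly"
  assumes J: "finite J" and a: "inj_on a J" and f: "degree f < card J"
    and t: "t \<notin> a ` J"
  shows "poly f t / (\<Prod>j\<in>J. t - a j) =
    (\<Sum>j\<in>J. poly f (a j) / ((t - a j) * (\<Prod>r\<in>J - {j}. a j - a r)))"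
proof -
  define w where "w j = (\<Prod>r\<in>J - {j}. a j - a r)" for j
  define P where "P = (\<Sum>j\<in>J. Polynomial.smult (poly f (a j) / w j) (\<Prod>r\<in>J - {j}. [:- a r, 1:]))"
  have deg: "degree (\<Prod>r\<in>J - {j}. [:- a r, 1:]) \<le> card J - 1" if "j \<in> J" for j
    using degree_prod_sum_le[of "J - {j}" "\<lambda>r. [:- a r, 1:]"] J that by simp
  have "degree P \<le> card J - 1"
    unfolding P_def
  proof (rule degree_sum_le[OF J])
    fix j assume "j \<in> J"
    then show "degree (Polynomial.smult (poly f (a j) / w j) (\<Prod>r\<in>J - {j}. [:- a r, 1:])) \<le> card J - 1"
      by (rule order.trans[OF degree_smult_le deg])
  qed
  then have degP: "degree P < card J"
    using f by linarith
  have w: "w j \<noteq> 0" if "j \<in> J" for j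
    unfolding w_def
  proof (subst prod_zero_iff)
    show "\<not> (\<exists>r\<in>J - {j}. a j - a r = 0)"
      using that a by (auto dest: inj_onD)
  qed (use J in simp)
  have poly_P: "poly P x = (\<Sum>j\<in>J. poly f (a j) / w j * (\<Prod>r\<in>J - {j}. x - a r))" for x
    by (simp add: P_def poly_sum poly_prod)
  have node: "poly P (a k) = poly f (a k)" if k: "k \<in> J" for k
  proof -
    have "poly P (a k) = (\<Sum>j\<in>J. if j = k then poly f (a k) else 0)"
      unfolding poly_P
    proof (rule sum.cong[OF refl])
      fix j assume "j \<in> J"
      show "poly f (a j) / w j * (\<Prod>r\<in>J - {j}. a k - a r) = (if j = k then poly f (a k) else 0)"
      proof (cases "j = k")
        case True
        then show ?thesis using w[OF k] by (simp add: w_def[of k])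
      next
        case False
        then have "(\<Prod>r\<in>J - {j}. a k - a r) = 0"
          using J k by (intro prod_zero) auto
        then show ?thesis using False by simp
      qed
    qed
    then show ?thesis using J k by simp
  qed
  have "P = f"
    using node degP f a by (intro poly_eqI_degree[of "a ` J"]) (auto simp: card_image)
  then have "poly f t / (\<Prod>j\<in>J. t - a j) =
    (\<Sum>j\<in>J. poly f (a j) / w j * (\<Prod>r\<in>J - {j}. t - a r)) / (\<Prod>j\<in>J. t - a j)"
    using poly_P[of t] by (simp only:)
  also have "\<dots> = (\<Sum>j\<in>J. poly f (a j) / ((t - a j) * w j))"
    unfolding sum_divide_distrib
  proof (rule sum.cong[OF refl])
    fix j assume j: "j \<in> J"
    have "(\<Prod>j\<in>J. t - a j) = (t - a j) * (\<Prod>r\<in>J - {j}. t - a r)"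
      using J j by (rule prod.remove)
    moreover have "(\<Prod>r\<in>J - {j}. t - a r) \<noteq> 0"
      using J t by auto
    ultimately show "poly f (a j) / w j * (\<Prod>r\<in>J - {j}. t - a r) / (\<Prod>j\<in>J. t - a j) =
      poly f (a j) / ((t - a j) * w j)"
      by simp
  qed
  finally show ?thesis by (simp add: w_def)
qed

lemma prod_atMost_split_0:
  fixes f :: "nat \<Rightarrow> 'a::comm_monoid_mult"
  shows "(\<Prod>j\<le>K. f j) = f 0 * (\<Prod>j=1..K. f j)"
  by (simp add: prod.atLeast1_atMost_eq prod.atMost_shift)

lemma qpow_0 [simp]: "qpow \<tau> 0 = 1"
  and qpow_add: "qpow \<tau> (x + y) = qpow \<tau> x * qpow \<tau> y"
  and qpow_minus: "qpow \<tau> (- x) = inverse (qpow \<tau> x)"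
  and qpow_nonzero [simp]: "qpow \<tau> x \<noteq> 0"
  by (simp_all add: qpow_def exp_add exp_minus distrib_left)

lemma qpow_of_int: "qpow \<tau> (of_int n) = exp \<tau> powi n"
  by (simp add: qpow_def exp_power_int mult.commute)

lemma qpow_of_nat: "qpow \<tau> (of_nat n) = exp \<tau> ^ n"
  using qpow_of_int[of \<tau> "int n"] by simp

lemma qnum_minus: "qnum \<tau> (- x) = - qnum \<tau> x"
  by (simp add: qnum_def diff_divide_distrib)

lemma qnum_0 [simp]: "qnum \<tau> 0 = 0"
  by (simp add: qnum_def)

lemma qfact_0 [simp]: "qfact \<tau> 0 = 1"
  by (simp add: qfact_def)

lemma qfact_Suc: "qfact \<tau> (Suc n) = qnum \<tau> (of_nat (Suc n)) * qfact \<tau> n"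
  by (simp add: qfact_def mult.commute)

section \<open>Identities between \<open>q\<close>-numbers\<close>

locale generic_parameter =
  fixes \<tau> :: complex
  assumes not_root_of_unity: "\<forall>n::nat. n > 0 \<longrightarrow> exp \<tau> ^ n \<noteq> 1"
begin

abbreviation qn :: "complex \<Rightarrow> complex" ("\<lbrakk>_\<rbrakk>") where "\<lbrakk>x\<rbrakk> \<equiv> qnum \<tau> x"

lemma powi_eq_1_iff: "exp \<tau> powi n = 1 \<longleftrightarrow> n = 0"
proof
  assume n: "exp \<tau> powi n = 1"
  show "n = 0"
  proof (rule ccontr)
    assume "n \<noteq> 0"
    moreover have "exp \<tau> ^ nat \<bar>n\<bar> = 1"
      using n by (cases "n \<ge> 0") (auto simp: power_int_def power_inverse)
    ultimately show False using not_root_of_unity by auto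
  qed
qed simp

lemma powi_eq_iff: "exp \<tau> powi m = exp \<tau> powi n \<longleftrightarrow> m = n"
  using powi_eq_1_iff[of "m - n"] by (simp add: power_int_diff)

lemma qdiff_nonzero: "qpow \<tau> 1 - qpow \<tau> (- 1) \<noteq> 0"
  using powi_eq_iff[of 1 "-1"] qpow_of_int[of \<tau> 1] qpow_of_int[of \<tau> "-1"] by simp

lemma qnum_eq_0_iff: "\<lbrakk>x\<rbrakk> = 0 \<longleftrightarrow> qpow \<tau> (2 * x) = 1"
proof -
  have "\<lbrakk>x\<rbrakk> = 0 \<longleftrightarrow> qpow \<tau> x = qpow \<tau> (- x)"
    using qdiff_nonzero by (simp add: qnum_def)
  also have "\<dots> \<longleftrightarrow> qpow \<tau> x * qpow \<tau> x = 1"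
    by (simp add: qpow_minus inverse_eq_divide eq_divide_eq)
  finally show ?thesis
    using qpow_add[of \<tau> x x] by simp
qed

lemma qnum_of_int_nonzero: "n \<noteq> 0 \<Longrightarrow> \<lbrakk>of_int n\<rbrakk> \<noteq> 0"
  using powi_eq_1_iff[of "2 * n"] qpow_of_int[of \<tau> "2 * n"]
  by (simp only: qnum_eq_0_iff of_int_mult of_int_numeral)

lemma qfact_nonzero: "qfact \<tau> n \<noteq> 0"
proof -
  have "\<lbrakk>of_nat j\<rbrakk> \<noteq> 0" if "j > 0" for j
    using qnum_of_int_nonzero[of "int j"] that by simp
  then show ?thesis
    unfolding qfact_def by (simp add: prod_zero_iff)
qed

text \<open>
  This is the recursion behind \<open>E F\<^bsup>j+1\<^esup> v = [j+1] [l-j] F\<^bsup>j\<^esup> v\<close> for a highest weight vector \<open>v\<close> of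
  weight \<open>l\<close>: for \<open>x = j\<close> and \<open>y = l - j\<close> the last term is the eigenvalue \<open>[l - 2 j]\<close> of \<open>E F - F E\<close>
  on \<open>F\<^bsup>j\<^esup> v\<close>.
\<close>

lemma qnum_exchange: "\<lbrakk>x + 1\<rbrakk> * \<lbrakk>y\<rbrakk> = \<lbrakk>x\<rbrakk> * \<lbrakk>y + 1\<rbrakk> + \<lbrakk>y - x\<rbrakk>"
proof -
  define d where "d = qpow \<tau> 1 - qpow \<tau> (- 1)"
  have d: "d \<noteq> 0" using qdiff_nonzero by (simp add: d_def)
  define Q X Y where "Q = qpow \<tau> 1" and "X = qpow \<tau> x" and "Y = qpow \<tau> y"
  have nz: "Q \<noteq> 0" "X \<noteq> 0" "Y \<noteq> 0" by (auto simp: Q_def X_def Y_def)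
  have n: "\<lbrakk>x + 1\<rbrakk> = (X * Q - 1 / (X * Q)) / d" "\<lbrakk>y\<rbrakk> = (Y - 1 / Y) / d" "\<lbrakk>x\<rbrakk> = (X - 1 / X) / d"
    "\<lbrakk>y + 1\<rbrakk> = (Y * Q - 1 / (Y * Q)) / d" "\<lbrakk>y - x\<rbrakk> = (Y / X - X / Y) / d"
    using qpow_add[of \<tau> x 1] qpow_add[of \<tau> y 1] qpow_add[of \<tau> y "-x"]
      qpow_minus[of \<tau> "x + 1"] qpow_minus[of \<tau> "y + 1"] qpow_minus[of \<tau> "y - x"]
      qpow_minus[of \<tau> x] qpow_minus[of \<tau> y]
    unfolding qnum_def d_def[symmetric]
    by (simp_all add: X_def Y_def Q_def divide_inverse mult.commute)
  have dQ: "d = Q - 1 / Q" by (simp add: d_def Q_def qpow_minus divide_inverse)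
  have "(X * Q - 1 / (X * Q)) * (Y - 1 / Y) =
      (X - 1 / X) * (Y * Q - 1 / (Y * Q)) + (Y / X - X / Y) * (Q - 1 / Q)"
    using nz by (simp add: field_simps)
  then show ?thesis
    unfolding n dQ[symmetric] using d by (simp add: add_divide_distrib)
qed

lemma qpow_diff: "qpow \<tau> (x + y) - qpow \<tau> (x - y) = (qpow \<tau> 1 - qpow \<tau> (- 1)) * (qpow \<tau> x * \<lbrakk>y\<rbrakk>)"
proof -
  have "(qpow \<tau> 1 - qpow \<tau> (- 1)) * \<lbrakk>y\<rbrakk> = qpow \<tau> y - qpow \<tau> (- y)"
    using qdiff_nonzero by (simp add: qnum_def)
  then have "qpow \<tau> x * (qpow \<tau> y - qpow \<tau> (- y)) = qpow \<tau> x * ((qpow \<tau> 1 - qpow \<tau> (- 1)) * \<lbrakk>y\<rbrakk>)"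
    by simp
  then show ?thesis
    using qpow_add[of \<tau> x y] qpow_add[of \<tau> x "- y"] by (simp add: algebra_simps)
qed

lemma qfact_telescope: "(\<Prod>r=1..K. \<lbrakk>of_nat (n + r)\<rbrakk>) = qfact \<tau> (n + K) / qfact \<tau> n"
  by (induction K) (simp_all add: qfact_Suc qfact_nonzero del: of_nat_Suc of_nat_add)

lemma qfact_punctured:
  assumes "j \<le> K"
  shows "(\<Prod>r\<in>{..K} - {j}. \<lbrakk>of_nat j - of_nat r\<rbrakk>) = (-1) ^ (K - j) * qfact \<tau> j * qfact \<tau> (K - j)"
proof -
  have split: "{..K} - {j} = {..<j} \<union> {Suc j..K}" using assms by auto
  have low: "(\<Prod>r<j. \<lbrakk>of_nat j - of_nat r\<rbrakk>) = qfact \<tau> j"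
    unfolding qfact_def
    by (rule prod.reindex_bij_witness[of _ "\<lambda>r. j - r" "\<lambda>r. j - r"]) (auto simp: of_nat_diff)
  have high: "(\<Prod>r=Suc j..K. \<lbrakk>of_nat j - of_nat r\<rbrakk>) = (\<Prod>r=1..K - j. - \<lbrakk>of_nat r\<rbrakk>)"
    by (rule prod.reindex_bij_witness[of _ "\<lambda>r. r + j" "\<lambda>r. r - j"])
      (auto simp: of_nat_diff qnum_minus[symmetric])
  show ?thesis
    unfolding split
    by (subst prod.union_disjoint) (auto simp: low high prod_uminus qfact_def)
qed

text \<open>
  With \<open>a\<^sub>j = q\<^bsup>p+2j\<^esup>\<close>, the sum divided by \<open>t - a\<^sub>0\<close> is the partial fraction expansion of a function whose
  numerator \<open>\<Prod>r=1..K. (1 - a\<^sub>r t)\<close> has degree \<open>K\<close> and whose poles are the \<open>K + 1\<close> points \<open>a\<^sub>j\<close>. Each factor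
  \<open>1 - a\<^sub>r a\<^sub>j\<close> of the numerator at \<open>a\<^sub>j\<close>, and each difference \<open>a\<^sub>j - a\<^sub>r\<close>, is a \<open>q\<close>-number times the same
  quantity \<open>g r j\<close> (up to sign), so the residues are quotients of \<open>q\<close>-factorials. The powers of \<open>q\<close>
  contained in \<open>g\<close> cancel except for \<open>g j j / g 0 j = q\<^bsup>j\<^esup>\<close>, because the numerator omits \<open>r = 0\<close> and the
  denominator omits \<open>r = j\<close>.
\<close>

lemma dynamical_sum:
  fixes p K :: nat and x :: complex
  assumes gen: "\<And>j. j \<le> K \<Longrightarrow> \<lbrakk>x + of_nat j + of_nat p / 2\<rbrakk> \<noteq> 0"
  defines "t \<equiv> qpow \<tau> (- 2 * x)"
  shows "(\<Sum>j\<le>K. (- exp \<tau>) ^ j * ((t - exp \<tau> ^ p) / (t - exp \<tau> ^ (2 * j + p))) *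
            (qfact \<tau> (j + p + K) / (qfact \<tau> j * qfact \<tau> (j + p) * qfact \<tau> (K - j)))) =
         (-1) ^ K * (\<Prod>j=1..K. \<lbrakk>x - of_nat j - of_nat p / 2\<rbrakk> / \<lbrakk>x + of_nat j + of_nat p / 2\<rbrakk>)"
proof -
  define a where "a j = qpow \<tau> (of_nat (2 * j + p))" for j
  define d where "d = qpow \<tau> 1 - qpow \<tau> (- 1)"
  define g where "g r j = d * qpow \<tau> (of_nat (p + j + r))" for j r
  define f where "f = (\<Prod>r=1..K. [:1, - a r:])"
  have d: "d \<noteq> 0" using qdiff_nonzero by (simp add: d_def)
  have g: "g r j \<noteq> 0" for r j using d by (simp add: g_def)
  have a_eq: "a j = exp \<tau> ^ (2 * j + p)" for j unfolding a_def by (rule qpow_of_nat)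
  have inj: "inj_on a {..K}"
  proof (rule inj_onI)
    fix j k assume "a j = a k"
    then show "j = k"
      using powi_eq_iff[of "int (2 * j + p)" "int (2 * k + p)"] by (simp add: a_eq del: of_nat_add of_nat_mult)
  qed
  have t_ne: "t - a j \<noteq> 0" if "j \<le> K" for j
  proof
    assume "t - a j = 0"
    then have "qpow \<tau> (2 * x) * t = qpow \<tau> (2 * x) * qpow \<tau> (of_nat (2 * j + p))"
      by (simp add: a_def)
    moreover have "qpow \<tau> (2 * x) * t = 1"
      by (simp add: t_def qpow_minus)
    ultimately have "qpow \<tau> (2 * (x + of_nat j + of_nat p / 2)) = 1"
      by (simp add: qpow_add[symmetric] algebra_simps)
    then show False using gen[OF that] by (simp add: qnum_eq_0_iff)
  qed
  have degf: "degree f < card {..K}"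
  proof -
    have "degree f \<le> (\<Sum>r=1..K. degree [:1, - a r:])"
      unfolding f_def by (rule order.trans[OF degree_prod_sum_le]) (auto simp: o_def)
    also have "\<dots> \<le> (\<Sum>r=1..K. 1)"
      by (rule sum_mono) simp
    finally show ?thesis by simp
  qed
  have poly_f: "poly f y = (\<Prod>r=1..K. 1 - a r * y)" for y
    by (simp add: f_def poly_prod mult.commute)
  have num: "poly f (a j) = (-1) ^ K * (\<Prod>r=1..K. g r j) * (qfact \<tau> (j + p + K) / qfact \<tau> (j + p))"
    for j
  proof -
    have "1 - a r * a j = - (g r j * \<lbrakk>of_nat (j + p + r)\<rbrakk>)" for r
    proof -
      have "a r * a j = qpow \<tau> (of_nat (p + j + r) + of_nat (p + j + r))"
        unfolding a_def qpow_add[symmetric] by (rule arg_cong[where f = "qpow \<tau>"]) simp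
      then have "a r * a j - 1 = g r j * \<lbrakk>of_nat (p + j + r)\<rbrakk>"
        using qpow_diff[of "of_nat (p + j + r)" "of_nat (p + j + r)"]
        by (simp add: g_def d_def mult.assoc del: of_nat_add)
      then show ?thesis by (simp add: algebra_simps)
    qed
    then have "poly f (a j) = (\<Prod>r=1..K. - (g r j * \<lbrakk>of_nat (j + p + r)\<rbrakk>))"
      by (simp add: poly_f)
    also have "\<dots> = (-1) ^ K * ((\<Prod>r=1..K. g r j) * (\<Prod>r=1..K. \<lbrakk>of_nat (j + p + r)\<rbrakk>))"
      by (simp only: prod_uminus prod.distrib card_atLeastAtMost diff_Suc_1)
    finally show ?thesis by (simp only: qfact_telescope mult.assoc)
  qed
  have den: "(\<Prod>r\<in>{..K} - {j}. a j - a r) =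
      (\<Prod>r\<in>{..K} - {j}. g r j) * ((-1) ^ (K - j) * qfact \<tau> j * qfact \<tau> (K - j))"
    if "j \<le> K" for j
  proof -
    have "a j - a r = g r j * \<lbrakk>of_nat j - of_nat r\<rbrakk>" for r
      using qpow_diff[of "of_nat (p + j + r)" "of_nat j - of_nat r"]
      by (simp add: a_def g_def d_def algebra_simps)
    then show ?thesis by (simp add: prod.distrib qfact_punctured[OF that])
  qed
  \<comment> \<open>Both sides arise from the product over all \<open>r \<le> K\<close> by removing one factor.\<close>
  have ratio: "(\<Prod>r=1..K. g r j) = exp \<tau> ^ j * (\<Prod>r\<in>{..K} - {j}. g r j)" if "j \<le> K" for j
  proof -
    have "g 0 j * (\<Prod>r=1..K. g r j) = (\<Prod>r\<le>K. g r j)"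
      by (rule prod_atMost_split_0[symmetric])
    also have "\<dots> = g j j * (\<Prod>r\<in>{..K} - {j}. g r j)"
      using that by (intro prod.remove) auto
    also have "g j j = g 0 j * exp \<tau> ^ j"
      using qpow_add[of \<tau> "of_nat (p + j)" "of_nat j"]
      by (simp add: g_def qpow_of_nat[symmetric])
    finally show ?thesis using g[of 0 j] by simp
  qed
  have residue: "poly f (a j) / (\<Prod>r\<in>{..K} - {j}. a j - a r) = (- exp \<tau>) ^ j *
      (qfact \<tau> (j + p + K) / (qfact \<tau> j * qfact \<tau> (j + p) * qfact \<tau> (K - j)))" if j: "j \<le> K" for j
  proof -
    have "(-1::complex) ^ K = (-1) ^ j * (-1) ^ (K - j)"
      using j by (simp flip: power_add)
    moreover have "(- exp \<tau>) ^ j = (-1) ^ j * exp \<tau> ^ j"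
      by (rule power_minus)
    moreover have "(\<Prod>r\<in>{..K} - {j}. g r j) \<noteq> 0" using g by simp
    ultimately show ?thesis
      unfolding num den[OF j] ratio[OF j] by (simp add: ac_simps)
  qed
  have "(\<Sum>j\<le>K. (- exp \<tau>) ^ j * ((t - exp \<tau> ^ p) / (t - exp \<tau> ^ (2 * j + p))) *
            (qfact \<tau> (j + p + K) / (qfact \<tau> j * qfact \<tau> (j + p) * qfact \<tau> (K - j)))) =
        (t - a 0) * (\<Sum>j\<le>K. poly f (a j) / ((t - a j) * (\<Prod>r\<in>{..K} - {j}. a j - a r)))"
    unfolding sum_distrib_left
  proof (rule sum.cong[OF refl])
    fix j assume "j \<in> {..K}"
    then have j: "j \<le> K" by simp
    have "poly f (a j) / ((t - a j) * (\<Prod>r\<in>{..K} - {j}. a j - a r)) =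
        poly f (a j) / (\<Prod>r\<in>{..K} - {j}. a j - a r) / (t - a j)"
      by simp
    then show "(- exp \<tau>) ^ j * ((t - exp \<tau> ^ p) / (t - exp \<tau> ^ (2 * j + p))) *
        (qfact \<tau> (j + p + K) / (qfact \<tau> j * qfact \<tau> (j + p) * qfact \<tau> (K - j))) =
      (t - a 0) * (poly f (a j) / ((t - a j) * (\<Prod>r\<in>{..K} - {j}. a j - a r)))"
      unfolding residue[OF j] by (simp add: a_eq ac_simps)
  qed
  also have "\<dots> = (t - a 0) * (poly f t / (\<Prod>j\<le>K. t - a j))"
    using t_ne by (subst lagrange_interpolation[OF _ inj degf]) auto
  also have "(\<Prod>j\<le>K. t - a j) = (t - a 0) * (\<Prod>j=1..K. t - a j)"
    by (rule prod_atMost_split_0)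
  also have "(t - a 0) * (poly f t / ((t - a 0) * (\<Prod>j=1..K. t - a j))) = (\<Prod>j=1..K. (1 - a j * t) / (t - a j))"
    using t_ne[of 0] by (simp add: poly_f prod_dividef)
  also have "\<dots> = (\<Prod>j=1..K. - (\<lbrakk>x - of_nat j - of_nat p / 2\<rbrakk> / \<lbrakk>x + of_nat j + of_nat p / 2\<rbrakk>))"
  proof (rule prod.cong[OF refl])
    fix j assume "j \<in> {1..K}"
    define c where "c = of_nat j + of_nat p / (2 :: complex)"
    have ac: "a j = qpow \<tau> (2 * c)" by (simp add: a_def c_def algebra_simps)
    have 1: "1 - a j * t = - d * (qpow \<tau> (c - x) * - \<lbrakk>x - c\<rbrakk>)"
      using qpow_diff[of "c - x" "c - x"]
      by (simp add: ac t_def d_def qpow_add[symmetric] qnum_minus[symmetric] algebra_simps)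
    have 2: "t - a j = - d * (qpow \<tau> (c - x) * \<lbrakk>x + c\<rbrakk>)"
      using qpow_diff[of "c - x" "x + c"]
      by (simp add: ac t_def d_def algebra_simps)
    show "(1 - a j * t) / (t - a j) = - (\<lbrakk>x - of_nat j - of_nat p / 2\<rbrakk> / \<lbrakk>x + of_nat j + of_nat p / 2\<rbrakk>)"
      unfolding 1 2 using d by (simp add: c_def diff_diff_eq add.assoc)
  qed
  finally show ?thesis
    by (simp only: prod_uminus card_atLeastAtMost diff_Suc_1)
qed

text \<open>
  Together with the factor in front, the numerators of the left hand side run over
  \<open>[x + p/2], \<dots>, [x + p/2 - k]\<close> and the denominators over \<open>[x - p/2], \<dots>, [x - p/2 + k]\<close>. The first
  \<open>p + 1\<close> of each list are the same numbers in opposite order.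
\<close>

lemma string_factor_reflect:
  fixes p k :: nat and x :: complex
  assumes gen: "\<And>j. j \<le> p \<Longrightarrow> \<lbrakk>x + of_nat j - of_nat p / 2\<rbrakk> \<noteq> 0" and pk: "p \<le> k"
  shows "\<lbrakk>x + of_nat p / 2\<rbrakk> / \<lbrakk>x - of_nat p / 2\<rbrakk> *
      (\<Prod>j=1..k. \<lbrakk>x + of_nat p / 2 - of_nat j\<rbrakk> / \<lbrakk>x - of_nat p / 2 + of_nat j\<rbrakk>) =
    (\<Prod>j=1..k - p. \<lbrakk>x - of_nat j - of_nat p / 2\<rbrakk> / \<lbrakk>x + of_nat j + of_nat p / 2\<rbrakk>)"
proof -
  define n where "n j = \<lbrakk>x + of_nat p / 2 - of_nat j\<rbrakk>" for j :: nat
  define e where "e j = \<lbrakk>x - of_nat p / 2 + of_nat j\<rbrakk>" for j :: nat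
  have "\<lbrakk>x + of_nat p / 2\<rbrakk> / \<lbrakk>x - of_nat p / 2\<rbrakk> * (\<Prod>j=1..k. n j / e j) = (\<Prod>j\<le>k. n j / e j)"
    by (simp add: prod_atMost_split_0 n_def e_def)
  also have "{..k} = {..p} \<union> {Suc p..k}" using pk by auto
  also have "(\<Prod>j\<in>{..p} \<union> {Suc p..k}. n j / e j) = (\<Prod>j\<le>p. n j / e j) * (\<Prod>j=Suc p..k. n j / e j)"
    by (rule prod.union_disjoint) auto
  \<comment> \<open>Reversing the order of the factors maps \<open>n j\<close> to \<open>e (p - j)\<close>.\<close>
  also have "(\<Prod>j\<le>p. n j / e j) = 1"
  proof -
    have "(\<Prod>j\<le>p. n j) = (\<Prod>j\<le>p. e j)"
      by (rule prod.reindex_bij_witness[of _ "\<lambda>j. p - j" "\<lambda>j. p - j"])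
        (auto simp: n_def e_def of_nat_diff intro!: arg_cong[where f = "qnum \<tau>"])
    moreover have "(\<Prod>j\<le>p. e j) \<noteq> 0"
      using gen by (auto simp: e_def algebra_simps)
    ultimately show ?thesis by (simp add: prod_dividef)
  qed
  also have "(\<Prod>j=Suc p..k. n j / e j) =
      (\<Prod>j=1..k - p. \<lbrakk>x - of_nat j - of_nat p / 2\<rbrakk> / \<lbrakk>x + of_nat j + of_nat p / 2\<rbrakk>)"
  proof (rule prod.reindex_bij_witness[of _ "\<lambda>j. j + p" "\<lambda>j. j - p"])
    fix j assume "j \<in> {Suc p..k}"
    then have *: "of_nat (j - p) = (of_nat j - of_nat p :: complex)"
      by (simp add: of_nat_diff)
    have "x - of_nat (j - p) - of_nat p / 2 = x + of_nat p / 2 - of_nat j"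
      "x + of_nat (j - p) + of_nat p / 2 = x - of_nat p / 2 + of_nat j"
      unfolding * by (simp_all add: field_simps)
    then show "\<lbrakk>x - of_nat (j - p) - of_nat p / 2\<rbrakk> / \<lbrakk>x + of_nat (j - p) + of_nat p / 2\<rbrakk> = n j / e j"
      by (simp only: n_def e_def)
  qed auto
  finally show ?thesis by (simp add: n_def e_def)
qed

text \<open>
  The scalar by which the dynamical Weyl group operator has to be multiplied on vectors of weight \<open>m\<close>. For
  \<open>m = 0\<close> both branches agree wherever \<open>[x]\<close> does not vanish.
\<close>

definition normalization :: "int \<Rightarrow> complex \<Rightarrow> complex" where
  "normalization m x =
    (if 0 \<le> m then exp \<tau> powi (- m)
     else (-1) powi m * exp \<tau> powi (- m) * (\<lbrakk>x - of_int m / 2\<rbrakk> / \<lbrakk>x + of_int m / 2\<rbrakk>))"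

text \<open>
  The coefficient of \<open>v\<^sub>-\<^sub>m\<close> in the image of \<open>v\<^sub>m\<close>, \<open>m = l - 2 k\<close>, under the dynamical Weyl group operator.
\<close>

definition weyl_coefficient :: "nat \<Rightarrow> nat \<Rightarrow> complex \<Rightarrow> complex" where
  "weyl_coefficient l k x = (-1) ^ k * exp \<tau> powi (int l - 2 * int k) *
     (\<Prod>j=1..k. \<lbrakk>x + of_nat k - of_nat j - of_nat l / 2\<rbrakk> / \<lbrakk>x - of_nat k + of_nat j + of_nat l / 2\<rbrakk>)"

text \<open>
  If all weights of a module are bounded by \<open>N\<close>, then every denominator that matters in the series, in
  the Weyl group coefficients and in the normalization is of the form \<open>[x + r/2]\<close> with \<open>|r| \<le> N\<close>, up to a
  nonzero factor; so is the numerator of the normalization.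
\<close>

definition regular :: "nat \<Rightarrow> complex \<Rightarrow> bool" where
  "regular N x \<longleftrightarrow> (\<forall>r::int. \<bar>r\<bar> \<le> int N \<longrightarrow> \<lbrakk>x + of_int r / 2\<rbrakk> \<noteq> 0)"

lemma normalization_nonzero: "regular N x \<Longrightarrow> \<bar>m\<bar> \<le> int N \<Longrightarrow> normalization m x \<noteq> 0"
  unfolding regular_def by (auto simp: normalization_def dest: spec[of _ m] spec[of _ "- m"])

text \<open>
  The right hand side is the value found in \<open>dynamical_sum\<close>; it depends only on \<open>|m|\<close> and on the distance
  \<open>K\<close> of the vector from the nearer end of its string.
\<close>

lemma normalized_weyl_coefficient:
  fixes l k :: nat
  assumes reg: "regular N x" and l: "l \<le> N" and k: "k \<le> l"
  defines "m \<equiv> int l - 2 * int k" and "K \<equiv> min k (l - k)"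
  defines "p \<equiv> nat \<bar>m\<bar>"
  shows "normalization m x * weyl_coefficient l k x =
    (-1) ^ K * (\<Prod>j=1..K. \<lbrakk>x - of_nat j - of_nat p / 2\<rbrakk> / \<lbrakk>x + of_nat j + of_nat p / 2\<rbrakk>)"
proof (cases "0 \<le> m")
  case True
  then have K: "K = k" and lp: "l = p + 2 * k" by (auto simp: m_def K_def p_def)
  have one: "exp \<tau> powi (- m) * exp \<tau> powi m = 1" by (simp add: power_int_minus)
  have eqs: "x + of_nat k - of_nat j - of_nat l / 2 = x - of_nat j - of_nat p / 2"
    "x - of_nat k + of_nat j + of_nat l / 2 = x + of_nat j + of_nat p / 2" for j
    by (simp_all add: lp field_simps)
  show ?thesis
    unfolding normalization_def weyl_coefficient_def m_def[symmetric] K eqs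
    using True by (simp add: one mult.assoc[symmetric] mult.commute[of _ "(-1) ^ k"])
next
  case False
  then have m: "m = - int p" and K: "K = k - p" and lp: "l + p = 2 * k" and pk: "p \<le> k"
    using k by (auto simp: m_def K_def p_def)
  have lp': "of_nat l = 2 * of_nat k - (of_nat p :: complex)"
    using arg_cong[OF lp, of "of_nat :: nat \<Rightarrow> complex"] by (simp add: eq_diff_eq)
  have eqs: "x + of_nat k - of_nat j - of_nat l / 2 = x + of_nat p / 2 - of_nat j"
    "x - of_nat k + of_nat j + of_nat l / 2 = x - of_nat p / 2 + of_nat j" for j
    unfolding lp' by (simp_all add: field_simps)
  have gen: "\<lbrakk>x + of_nat j - of_nat p / 2\<rbrakk> \<noteq> 0" if "j \<le> p" for j
  proof -
    have "\<bar>2 * int j - int p\<bar> \<le> int N"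
      using that l k pk lp by linarith
    then have "\<lbrakk>x + of_int (2 * int j - int p) / 2\<rbrakk> \<noteq> 0"
      using reg unfolding regular_def by blast
    then show ?thesis by (simp add: diff_divide_distrib add_diff_eq)
  qed
  have sgn: "(-1) powi m * (-1) ^ k = ((-1) ^ K :: complex)"
  proof -
    have "(-1 :: complex) ^ k = (-1) ^ p * (-1) ^ K"
      using pk by (simp add: K flip: power_add)
    then show ?thesis by (simp add: m power_int_minus flip: power_mult_distrib mult.assoc)
  qed
  have one: "exp \<tau> powi (- m) * exp \<tau> powi m = 1" by (simp add: power_int_minus)
  define R where "R = (\<Prod>j=1..k. \<lbrakk>x + of_nat p / 2 - of_nat j\<rbrakk> / \<lbrakk>x - of_nat p / 2 + of_nat j\<rbrakk>)"
  have "normalization m x * weyl_coefficient l k x =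
      ((-1) powi m * (-1) ^ k) * (exp \<tau> powi (- m) * exp \<tau> powi m) *
      (\<lbrakk>x + of_nat p / 2\<rbrakk> / \<lbrakk>x - of_nat p / 2\<rbrakk> * R)"
    unfolding normalization_def weyl_coefficient_def m_def[symmetric] eqs R_def
    using False by (simp add: m mult_ac)
  also have "\<dots> = (-1) ^ K * (\<lbrakk>x + of_nat p / 2\<rbrakk> / \<lbrakk>x - of_nat p / 2\<rbrakk> * R)"
    by (simp only: sgn one mult_1_right)
  also have "\<lbrakk>x + of_nat p / 2\<rbrakk> / \<lbrakk>x - of_nat p / 2\<rbrakk> * R =
      (\<Prod>j=1..K. \<lbrakk>x - of_nat j - of_nat p / 2\<rbrakk> / \<lbrakk>x + of_nat j + of_nat p / 2\<rbrakk>)"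
    unfolding R_def K using gen pk by (rule string_factor_reflect)
  finally show ?thesis .
qed

lemma tau_nonzero: "\<tau> \<noteq> 0"
  using not_root_of_unity by (auto dest: spec[of _ 1])

text \<open>
  \<open>[x + r/2]\<close> vanishes exactly where the entire function \<open>q\<^bsup>2x+r\<^esup>\<close> takes the value \<open>1\<close>. This function is not
  constant, as its logarithmic derivative is \<open>2 \<tau> \<noteq> 0\<close>, and finitely many values of \<open>r\<close> are involved.
\<close>

lemma eventually_regular: "eventually (regular N) (cosparse UNIV)"
proof -
  have ev: "eventually (\<lambda>x. \<lbrakk>x + of_int r / 2\<rbrakk> \<noteq> 0) (cosparse UNIV)" for r
  proof -
    define f where "f x = qpow \<tau> (2 * (x + of_int r / 2))" for x
    have "f analytic_on UNIV"
      unfolding f_def qpow_def by (intro analytic_intros)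
    then have "f meromorphic_on UNIV"
      by (rule analytic_on_imp_meromorphic_on)
    from meromorphic_imp_constant_or_avoid[OF this open_UNIV connected_UNIV, of 1]
    consider "eventually (\<lambda>x. f x = 1) (cosparse UNIV)" | "eventually (\<lambda>x. f x \<noteq> 1) (cosparse UNIV)"
      by blast
    then show ?thesis
    proof cases
      case 1
      define x0 where "x0 = - of_int r / (2 :: complex)"
      have ev: "eventually (\<lambda>x. f x = 1) (at x0)"
        using eventually_cosparse_imp_eventually_at[OF 1, of x0 UNIV] by simp
      have "(f has_field_derivative 2 * \<tau>) (at x0)"
        unfolding f_def qpow_def
        by (auto intro!: derivative_eq_intros simp: x0_def)
      moreover have "(f has_field_derivative 0) (at x0)"
      proof -
        have "f x0 = 1" by (simp add: f_def x0_def)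
        then have "eventually (\<lambda>x. f x = 1) (nhds x0)"
          using ev by (simp add: eventually_nhds_conv_at)
        then show ?thesis
          by (subst DERIV_cong_ev[OF refl _ refl, of _ "\<lambda>_. 1"]) auto
      qed
      ultimately have "2 * \<tau> = 0" by (rule DERIV_unique)
      then show ?thesis using tau_nonzero by simp
    next
      case 2
      then show ?thesis by (simp add: qnum_eq_0_iff f_def)
    qed
  qed
  have "eventually (\<lambda>x. \<forall>r\<in>{- int N..int N}. \<lbrakk>x + of_int r / 2\<rbrakk> \<noteq> 0) (cosparse UNIV)"
    using ev by (simp add: eventually_ball_finite)
  then show ?thesis
    by (rule eventually_mono) (auto simp: regular_def abs_le_iff)
qed

end

section \<open>Strings in weight representations of quantum \<open>sl\<^sub>2\<close>\<close>

text \<open>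
  The part of the structure that is used to decompose a representation into strings. The sets \<open>V m\<close> are the
  spaces of vectors of weight \<open>m\<close>; they may be empty, which allows \<open>V\<close> to consist of the weight
  spaces along one root line, where only weights of one parity occur. The bound \<open>N\<close> on the weights
  replaces finite dimensionality.
\<close>

locale weighted_sl2 = vector_space scale + generic_parameter \<tau>
  for scale :: "complex \<Rightarrow> 'u::ab_group_add \<Rightarrow> 'u" (infixr "\<cdot>" 75) and \<tau> :: complex +
  fixes E F :: "'u \<Rightarrow> 'u" and V :: "int \<Rightarrow> 'u set" and N :: nat
  assumes linear_E: "Vector_Spaces.linear scale scale E"
    and linear_F: "Vector_Spaces.linear scale scale F"
    and V_add: "u \<in> V m \<Longrightarrow> v \<in> V m \<Longrightarrow> u + v \<in> V m"
    and V_scale: "u \<in> V m \<Longrightarrow> c \<cdot> u \<in> V m"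
    and E_V: "u \<in> V m \<Longrightarrow> E u \<in> V (m + 2)"
    and F_V: "u \<in> V m \<Longrightarrow> F u \<in> V (m - 2)"
    and commutator: "u \<in> V m \<Longrightarrow> E (F u) = F (E u) + \<lbrakk>of_int m\<rbrakk> \<cdot> u"
    and bounded: "u \<in> V m \<Longrightarrow> \<bar>m\<bar> > int N \<Longrightarrow> u = 0"
begin

sublocale E: Vector_Spaces.linear scale scale E by (rule linear_E)
sublocale F: Vector_Spaces.linear scale scale F by (rule linear_F)

text \<open>
  The Chevalley involution: exchanging \<open>E\<close> and \<open>F\<close> and negating weights preserves the assumptions, so
  that every statement on highest weight vectors is also one on lowest weight vectors.
\<close>

lemma opposite: "weighted_sl2 scale \<tau> F E (\<lambda>m. V (- m)) N"
proof unfold_locales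
  fix u m assume u: "u \<in> V (- m)"
  show "F u \<in> V (- (m + 2))" using F_V[OF u] by simp
  show "E u \<in> V (- (m - 2))" using E_V[OF u] by (simp add: algebra_simps)
  show "F (E u) = E (F u) + \<lbrakk>of_int m\<rbrakk> \<cdot> u"
    using commutator[OF u] by (simp add: qnum_minus)
  show "int N < \<bar>m\<bar> \<Longrightarrow> u = 0" using bounded[OF u] by simp
qed (auto simp: V_add V_scale)

lemma E_pow_scale: "(E ^^ n) (c \<cdot> u) = c \<cdot> (E ^^ n) u"
  and E_pow_add: "(E ^^ n) (u + v) = (E ^^ n) u + (E ^^ n) v"
  by (induction n) (auto simp: E.scale E.add)

lemma F_pow_scale: "(F ^^ n) (c \<cdot> u) = c \<cdot> (F ^^ n) u"
  and F_pow_add: "(F ^^ n) (u + v) = (F ^^ n) u + (F ^^ n) v"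
  by (induction n) (auto simp: F.scale F.add)

lemma E_pow_0 [simp]: "(E ^^ n) 0 = 0"
  and F_pow_0 [simp]: "(F ^^ n) 0 = 0"
  using E_pow_scale[of n 0 0] F_pow_scale[of n 0 0] by simp_all

lemma E_pow_V: "u \<in> V m \<Longrightarrow> (E ^^ n) u \<in> V (m + 2 * int n)"
proof (induction n)
  case (Suc n)
  then have "E ((E ^^ n) u) \<in> V (m + 2 * int n + 2)" by (intro E_V)
  then show ?case by (simp add: add.commute add.left_commute)
qed simp

lemma F_pow_V: "u \<in> V m \<Longrightarrow> (F ^^ n) u \<in> V (m - 2 * int n)"
proof (induction n)
  case (Suc n)
  then have "F ((F ^^ n) u) \<in> V (m - 2 * int n - 2)" by (intro F_V)
  then show ?case by (simp add: algebra_simps)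
qed simp

lemma E_nilpotent: "u \<in> V m \<Longrightarrow> n > N \<Longrightarrow> (E ^^ n) u = 0"
  and F_nilpotent: "u \<in> V m \<Longrightarrow> n > N \<Longrightarrow> (F ^^ n) u = 0"
proof -
  assume u: "u \<in> V m" and n: "n > N"
  show "(E ^^ n) u = 0"
  proof (cases "int N < \<bar>m\<bar>")
    case False
    then have "int N < \<bar>m + 2 * int n\<bar>" using n by linarith
    then show ?thesis using bounded[OF E_pow_V[OF u, of n]] by blast
  qed (simp add: bounded[OF u])
  show "(F ^^ n) u = 0"
  proof (cases "int N < \<bar>m\<bar>")
    case False
    then have "int N < \<bar>m - 2 * int n\<bar>" using n by linarith
    then show ?thesis using bounded[OF F_pow_V[OF u, of n]] by blast
  qed (simp add: bounded[OF u])
qed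

lemma E_F_pow_highest:
  assumes v: "v \<in> V m" "E v = 0"
  shows "E ((F ^^ Suc j) v) = (\<lbrakk>of_nat (Suc j)\<rbrakk> * \<lbrakk>of_int (m - int j)\<rbrakk>) \<cdot> (F ^^ j) v"
proof (induction j)
  case 0
  have "\<lbrakk>1\<rbrakk> = 1" using qdiff_nonzero by (simp add: qnum_def)
  then show ?case using commutator[OF v(1)] v(2) by simp
next
  case (Suc j)
  define w where "w = (F ^^ Suc j) v"
  have "w \<in> V (m - 2 * int (Suc j))"
    unfolding w_def using v(1) by (rule F_pow_V)
  then have "E (F w) = F (E w) + \<lbrakk>of_int (m - 2 * int (Suc j))\<rbrakk> \<cdot> w"
    by (rule commutator)
  also have "F (E w) = (\<lbrakk>of_nat (Suc j)\<rbrakk> * \<lbrakk>of_int (m - int j)\<rbrakk>) \<cdot> w"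
    unfolding w_def Suc.IH F.scale by simp
  also have "(\<lbrakk>of_nat (Suc j)\<rbrakk> * \<lbrakk>of_int (m - int j)\<rbrakk>) \<cdot> w + \<lbrakk>of_int (m - 2 * int (Suc j))\<rbrakk> \<cdot> w
      = (\<lbrakk>of_nat (Suc (Suc j))\<rbrakk> * \<lbrakk>of_int (m - int (Suc j))\<rbrakk>) \<cdot> w"
  proof -
    have "of_nat (Suc j) + 1 = (of_nat (Suc (Suc j)) :: complex)"
      "of_int (m - int (Suc j)) + 1 = (of_int (m - int j) :: complex)"
      "of_int (m - int (Suc j)) - of_nat (Suc j) = (of_int (m - 2 * int (Suc j)) :: complex)"
      by simp_all
    with qnum_exchange[of "of_nat (Suc j)" "of_int (m - int (Suc j))"]
    have "\<lbrakk>of_nat (Suc (Suc j))\<rbrakk> * \<lbrakk>of_int (m - int (Suc j))\<rbrakk> =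
        \<lbrakk>of_nat (Suc j)\<rbrakk> * \<lbrakk>of_int (m - int j)\<rbrakk> + \<lbrakk>of_int (m - 2 * int (Suc j))\<rbrakk>"
      by (simp only:)
    then show ?thesis by (simp only: scale_left_distrib)
  qed
  finally show ?case by (simp add: w_def)
qed

lemma E_pow_F_pow_highest:
  assumes v: "v \<in> V (int l)" "E v = 0" and "n \<le> l"
  shows "a \<le> n \<Longrightarrow> (E ^^ a) ((F ^^ n) v) =
    (qfact \<tau> n * qfact \<tau> (l - n + a) / (qfact \<tau> (n - a) * qfact \<tau> (l - n))) \<cdot> (F ^^ (n - a)) v"
proof (induction a)
  case 0
  then show ?case by (simp add: qfact_nonzero)
next
  case (Suc a)
  then obtain b where b: "n - a = Suc b" "n - Suc a = b" by (metis Suc_diff_Suc Suc_le_lessD)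
  have lb: "int l - int b = int (Suc (l - n + a))"
    using b Suc.prems \<open>n \<le> l\<close> by linarith
  have "(E ^^ Suc a) ((F ^^ n) v) =
      (qfact \<tau> n * qfact \<tau> (l - n + a) / (qfact \<tau> (n - a) * qfact \<tau> (l - n))) \<cdot> E ((F ^^ Suc b) v)"
    using Suc b by (simp add: E.scale)
  also have "E ((F ^^ Suc b) v) = (\<lbrakk>of_nat (Suc b)\<rbrakk> * \<lbrakk>of_nat (Suc (l - n + a))\<rbrakk>) \<cdot> (F ^^ b) v"
    unfolding E_F_pow_highest[OF v] lb of_int_of_nat_eq ..
  finally show ?case
    using qnum_of_int_nonzero[of "int (Suc b)"] unfolding b
    by (simp add: qfact_Suc del: of_nat_Suc)
qed

text \<open>
  For \<open>m < 0\<close> the coefficient \<open>[j+1] [m-j]\<close> in \<open>E F\<^bsup>j+1\<^esup> v\<close> never vanishes, so that \<open>F\<^bsup>j+1\<^esup> v = 0\<close> implies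
  \<open>F\<^bsup>j\<^esup> v = 0\<close>; but \<open>F\<close> is nilpotent.
\<close>

lemma highest_negative_zero:
  assumes v: "v \<in> V m" "E v = 0" and m: "m < 0"
  shows "v = 0"
proof -
  have "(F ^^ n) v = 0 \<Longrightarrow> v = 0" for n
  proof (induction n)
    case (Suc n)
    have "\<lbrakk>of_nat (Suc n)\<rbrakk> \<noteq> 0" "\<lbrakk>of_int (m - int n)\<rbrakk> \<noteq> 0"
      using qnum_of_int_nonzero[of "int (Suc n)"] qnum_of_int_nonzero[of "m - int n"] m by simp_all
    then show ?case
      using E_F_pow_highest[OF v, of n] Suc by simp
  qed simp
  then show ?thesis using F_nilpotent[OF v(1), of "Suc N"] by blast
qed

text \<open>
  \<open>F\<^bsup>l+1\<^esup> v\<close> is annihilated by \<open>E\<close> and has the negative weight \<open>- l - 2\<close>.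
\<close>

lemma F_pow_highest_zero:
  assumes v: "v \<in> V (int l)" "E v = 0" and n: "l < n"
  shows "(F ^^ n) v = 0"
proof -
  have "E ((F ^^ Suc l) v) = 0"
    using E_F_pow_highest[OF v, of l] by simp
  then have "(F ^^ Suc l) v = 0"
    using highest_negative_zero[OF F_pow_V[OF v(1), of "Suc l"]] by simp
  moreover obtain d where "n = d + Suc l" using n by (metis add.commute less_iff_Suc_add add_Suc_right)
  ultimately show ?thesis by (simp only: funpow_add o_apply F_pow_0)
qed

definition string_vectors :: "'u set" where
  "string_vectors = {(F ^^ k) v | k l v. v \<in> V (int l) \<and> E v = 0 \<and> k \<le> l}"

text \<open>
  If \<open>w = E\<^bsup>n\<^esup> u\<close> is the last nonzero vector in \<open>u, E u, E\<^bsup>2\<^esup> u, \<dots>\<close>, then \<open>w\<close> is a highest weight vector of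
  weight \<open>l = m + 2 n\<close>, and \<open>E\<^bsup>n\<^esup> F\<^bsup>n\<^esup> w = c w\<close> with \<open>c \<noteq> 0\<close> because \<open>n \<le> l\<close>. Hence subtracting
  \<open>F\<^bsup>n\<^esup> w / c\<close> from \<open>u\<close> gives a vector that is already annihilated by \<open>E\<^bsup>n\<^esup>\<close>. For \<open>m < - n\<close> the inequality
  \<open>n \<le> l\<close> fails, which is why negative weights need another argument.
\<close>

lemma nonneg_weight_in_strings:
  assumes "0 \<le> m" "u \<in> V m" "(E ^^ n) u = 0"
  shows "u \<in> span string_vectors"
  using assms
proof (induction n arbitrary: u)
  case 0
  then show ?case by (simp add: span_zero)
next
  case (Suc n)
  define l where "l = nat m + 2 * n"
  define w where "w = (E ^^ n) u"
  define c where "c = qfact \<tau> n * qfact \<tau> l / (qfact \<tau> 0 * qfact \<tau> (l - n))"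
  have c: "c \<noteq> 0" by (simp add: c_def qfact_nonzero)
  have w: "w \<in> V (int l)" "E w = 0"
    using E_pow_V[OF Suc.prems(2), of n] Suc.prems(1,3) by (simp_all add: w_def l_def)
  have nl: "n \<le> l" by (simp add: l_def)
  have Fw: "(F ^^ n) w \<in> V m"
    using F_pow_V[OF w(1), of n] Suc.prems(1) by (simp add: l_def)
  define u' where "u' = u + (- (1 / c)) \<cdot> (F ^^ n) w"
  have "u' \<in> V m"
    unfolding u'_def using Suc.prems(2) Fw by (intro V_add V_scale)
  moreover have "(E ^^ n) u' = 0"
  proof -
    have "(E ^^ n) u' = w + (- (1 / c)) \<cdot> (c \<cdot> w)"
      using E_pow_F_pow_highest[OF w nl order.refl] nl
      unfolding u'_def E_pow_add E_pow_scale by (simp only: c_def w_def diff_self_eq_0 funpow_0 le_add_diff_inverse2 less_imp_le)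
    also have "\<dots> = 0" using c by simp
    finally show ?thesis .
  qed
  ultimately have "u' \<in> span string_vectors"
    using Suc.IH Suc.prems(1) by blast
  moreover have "(F ^^ n) w \<in> span string_vectors"
    using w nl by (intro span_base) (auto simp: string_vectors_def)
  moreover have "u = u' + (1 / c) \<cdot> (F ^^ n) w"
    by (simp add: u'_def)
  ultimately show ?case by (metis span_add span_scale)
qed

text \<open>
  The decomposition of the previous lemma with \<open>E\<close> and \<open>F\<close> exchanged writes \<open>u\<close> as a sum of vectors
  \<open>E\<^bsup>n\<^esup> w\<close> with \<open>w\<close> of lowest weight \<open>- l\<close>. As the weight of \<open>E\<^bsup>n\<^esup> w\<close> is negative, \<open>n < l\<close>, and so
  \<open>E\<^bsup>n\<^esup> w\<close> is a nonzero multiple of \<open>F (E\<^bsup>n+1\<^esup> w)\<close>.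
\<close>

lemma negative_weight_in_F_image:
  assumes "m < 0" "u \<in> V m" "(F ^^ n) u = 0"
  shows "\<exists>y\<in>V (m + 2). u = F y"
  using assms
proof (induction n arbitrary: u)
  case 0
  then have "u = F (0 \<cdot> E u)" by simp
  then show ?case using 0 E_V V_scale by blast
next
  case (Suc n)
  interpret op: weighted_sl2 scale \<tau> F E "\<lambda>m. V (- m)" N by (rule opposite)
  define l where "l = nat (- m) + 2 * n"
  define w where "w = (F ^^ n) u"
  define c where "c = qfact \<tau> n * qfact \<tau> l / (qfact \<tau> 0 * qfact \<tau> (l - n))"
  define d where "d = \<lbrakk>of_nat (Suc n)\<rbrakk> * \<lbrakk>of_int (int l - int n)\<rbrakk>"
  have c: "c \<noteq> 0" by (simp add: c_def qfact_nonzero)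
  have w: "w \<in> V (- int l)" "F w = 0"
    using F_pow_V[OF Suc.prems(2), of n] Suc.prems(1,3) by (simp_all add: w_def l_def)
  have nl: "n < l" using Suc.prems(1) by (simp add: l_def)
  have d: "d \<noteq> 0"
    using qnum_of_int_nonzero[of "int (Suc n)"] qnum_of_int_nonzero[of "int l - int n"] nl
    by (simp add: d_def)
  have Ew: "(E ^^ n) w \<in> V m" "(E ^^ Suc n) w \<in> V (m + 2)"
    using E_pow_V[OF w(1), of n] E_pow_V[OF w(1), of "Suc n"] Suc.prems(1)
    by (simp_all add: l_def algebra_simps)
  define u' where "u' = u + (- (1 / c)) \<cdot> (E ^^ n) w"
  have "u' \<in> V m"
    unfolding u'_def using Suc.prems(2) Ew(1) by (intro V_add V_scale)
  moreover have "(F ^^ n) u' = 0"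
  proof -
    have "(F ^^ n) u' = w + (- (1 / c)) \<cdot> (c \<cdot> w)"
      using op.E_pow_F_pow_highest[OF w less_imp_le[OF nl] order.refl] nl
      unfolding u'_def F_pow_add F_pow_scale by (simp only: c_def w_def diff_self_eq_0 funpow_0 le_add_diff_inverse2 less_imp_le)
    also have "\<dots> = 0" using c by simp
    finally show ?thesis .
  qed
  ultimately obtain y where y: "y \<in> V (m + 2)" "u' = F y"
    using Suc.IH Suc.prems(1) by blast
  have "F ((E ^^ Suc n) w) = d \<cdot> (E ^^ n) w"
    unfolding d_def using w by (intro op.E_F_pow_highest) simp_all
  then have "F (y + (1 / (c * d)) \<cdot> (E ^^ Suc n) w) = u' + (1 / c) \<cdot> (E ^^ n) w"
    unfolding F.add F.scale y(2) using d by simp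
  also have "\<dots> = u" by (simp add: u'_def)
  finally have "u = F (y + (1 / (c * d)) \<cdot> (E ^^ Suc n) w)" ..
  moreover have "y + (1 / (c * d)) \<cdot> (E ^^ Suc n) w \<in> V (m + 2)"
    using y(1) Ew(2) by (intro V_add V_scale)
  ultimately show ?case by blast
qed

lemma F_span_strings: "y \<in> span string_vectors \<Longrightarrow> F y \<in> span string_vectors"
proof (induction rule: span_induct_alt)
  case base
  show ?case by (simp add: F.zero span_zero)
next
  case (step c x y)
  obtain k l v where x: "x = (F ^^ k) v" "v \<in> V (int l)" "E v = 0" "k \<le> l"
    using step(1) by (auto simp: string_vectors_def)
  have "F x \<in> span string_vectors"
  proof (cases "k = l")
    case True
    then show ?thesis
      using F_pow_highest_zero[OF x(2,3), of "Suc l"] x(1) by (simp add: span_zero)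
  next
    case False
    then have "F x = (F ^^ Suc k) v" "Suc k \<le> l" using x by auto
    then show ?thesis using x(2,3) by (intro span_base) (auto simp only: string_vectors_def)
  qed
  then show ?case using step by (simp add: F.add F.scale span_add span_scale)
qed

lemma weight_vector_in_strings: "u \<in> V m \<Longrightarrow> u \<in> span string_vectors"
proof (induction "nat (- m)" arbitrary: m u rule: less_induct)
  case less
  show ?case
  proof (cases "0 \<le> m")
    case True
    then show ?thesis
      using less.prems E_nilpotent[OF less.prems lessI] by (rule nonneg_weight_in_strings)
  next
    case False
    then have m: "m < 0" by simp
    obtain y where y: "y \<in> V (m + 2)" "u = F y"
      using negative_weight_in_F_image[OF m less.prems F_nilpotent[OF less.prems lessI]] by blast
    have "nat (- (m + 2)) < nat (- m)" using m by linarith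
    then have "y \<in> span string_vectors" using y(1) by (rule less.hyps)
    then show ?thesis unfolding y(2) by (rule F_span_strings)
  qed
qed

text \<open>
  The operators \<open>E\<^bsup>(a)\<^esup> F\<^bsup>(b)\<^esup>\<close> of the series, with \<open>a = j + (-m)\<^sub>+\<close> and \<open>b = j + m\<^sub>+\<close>, go down from \<open>F\<^bsup>(k)\<^esup> v\<close> to
  \<open>F\<^bsup>b+k\<^esup> v\<close>, which vanishes once \<open>b + k > l\<close>, that is \<open>j > K\<close>, and back up to \<open>F\<^bsup>l-k\<^esup> v\<close>. The coefficient
  depends only on \<open>|m|\<close> and \<open>K\<close>, because \<open>a\<close> and \<open>b\<close> are \<open>j\<close> and \<open>j + |m|\<close> in one order or the other.
\<close>

lemma divided_powers_on_string:
  fixes m :: int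
  assumes v: "v \<in> V (int l)" "E v = 0" and k: "k \<le> l"
  defines "m \<equiv> int l - 2 * int k" and "K \<equiv> min k (l - k)"
  shows "(1 / qfact \<tau> (j + nat (- m))) \<cdot> (E ^^ (j + nat (- m)))
      ((1 / qfact \<tau> (j + nat m)) \<cdot> (F ^^ (j + nat m)) ((1 / qfact \<tau> k) \<cdot> (F ^^ k) v)) =
    (if j \<le> K then qfact \<tau> (j + nat \<bar>m\<bar> + K) / (qfact \<tau> j * qfact \<tau> (j + nat \<bar>m\<bar>) * qfact \<tau> (K - j))
     else 0) \<cdot> ((1 / qfact \<tau> (l - k)) \<cdot> (F ^^ (l - k)) v)"
proof -
  define a b n where "a = j + nat (- m)" and "b = j + nat m" and "n = b + k"
  have lhs: "(1 / qfact \<tau> a) \<cdot> (E ^^ a) ((1 / qfact \<tau> b) \<cdot> (F ^^ b) ((1 / qfact \<tau> k) \<cdot> (F ^^ k) v))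
      = (1 / (qfact \<tau> a * qfact \<tau> b * qfact \<tau> k)) \<cdot> (E ^^ a) ((F ^^ n) v)"
    by (simp add: E_pow_scale F_pow_scale n_def funpow_add mult.assoc)
  have n_le: "n \<le> l \<longleftrightarrow> j \<le> K"
    using k unfolding n_def b_def m_def K_def by linarith
  show ?thesis
  proof (cases "j \<le> K")
    case False
    then show ?thesis
      unfolding a_def[symmetric] b_def[symmetric] lhs
      using F_pow_highest_zero[OF v, of n] n_le by simp
  next
    case True
    have an: "a \<le> n" "n - a = l - k" "n = j + nat \<bar>m\<bar> + K"
      using True k unfolding n_def a_def b_def m_def K_def by linarith+
    have ln: "l - n = K - j"
      using True k unfolding n_def b_def m_def K_def by linarith
    have lna: "l - n + a = k"
      using True k unfolding n_def b_def m_def K_def a_def by linarith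
    have ab: "qfact \<tau> a * qfact \<tau> b = qfact \<tau> j * qfact \<tau> (j + nat \<bar>m\<bar>)"
      by (cases "m \<ge> 0") (auto simp: a_def b_def)
    have "(E ^^ a) ((F ^^ n) v) = (qfact \<tau> n * qfact \<tau> k / (qfact \<tau> (l - k) * qfact \<tau> (K - j))) \<cdot> (F ^^ (l - k)) v"
      using E_pow_F_pow_highest[OF v n_le[THEN iffD2, OF True] an(1)] by (simp only: an(2) ln lna[unfolded ln])
    then show ?thesis
      unfolding a_def[symmetric] b_def[symmetric] lhs ab
      using True qfact_nonzero by (simp add: an(3)[symmetric] mult_ac)
  qed
qed

end

section \<open>Eigenprojections\<close>

locale linear_operator = vector_space scale
  for scale :: "'a::field \<Rightarrow> 'b::ab_group_add \<Rightarrow> 'b" (infixr "\<cdot>" 75) +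
  fixes K :: "'b \<Rightarrow> 'b"
  assumes linear_K: "Vector_Spaces.linear scale scale K"
begin

sublocale K: Vector_Spaces.linear scale scale K by (rule linear_K)


text \<open>
  The projection is the Lagrange polynomial in \<open>K\<close> with value \<open>1\<close> at \<open>c\<close> and \<open>0\<close> on \<open>S\<close>, built one
  factor \<open>(K - s) / (c - s)\<close> at a time.
\<close>

lemma eigenprojection:
  assumes S: "finite S" and c: "c \<notin> S"
  shows "\<exists>P. Vector_Spaces.linear scale scale P \<and> (\<forall>u. K u = c \<cdot> u \<longrightarrow> P u = u) \<and>
    (\<forall>s\<in>S. \<forall>u. K u = s \<cdot> u \<longrightarrow> P u = 0)"
  using S c
proof (induction S)
  case empty
  show ?case by (intro exI[of _ "\<lambda>u. u"]) (simp add: linear_ident)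
next
  case (insert s S)
  then obtain P where P: "Vector_Spaces.linear scale scale P"
    "\<And>u. K u = c \<cdot> u \<Longrightarrow> P u = u" "\<And>s u. s \<in> S \<Longrightarrow> K u = s \<cdot> u \<Longrightarrow> P u = 0"
    by auto
  interpret P: Vector_Spaces.linear scale scale P by (rule P(1))
  define Q where "Q u = P ((1 / (c - s)) \<cdot> (K u - s \<cdot> u))" for u
  have Q: "Q u = ((t - s) / (c - s)) \<cdot> P u" if "K u = t \<cdot> u" for t u
    unfolding Q_def that P.scale[symmetric] by (simp add: scale_left_diff_distrib[symmetric])
  have "Vector_Spaces.linear scale scale Q"
    unfolding Vector_Spaces.linear_iff
    by (simp add: Q_def K.add K.scale P.add P.scale P.diff scale_right_distrib
        scale_right_diff_distrib vector_space_axioms mult_ac)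
  moreover have "Q u = u" if "K u = c \<cdot> u" for u
    using Q[OF that] P(2)[OF that] insert.prems by auto
  moreover have "Q u = 0" if "r \<in> insert s S" "K u = r \<cdot> u" for r u
    using Q[OF that(2)] that P(3) by auto
  ultimately show ?case by blast
qed

lemma eigenvectors_independent:
  assumes eig: "\<And>v. v \<in> B \<Longrightarrow> K v = ev v \<cdot> v" and nz: "0 \<notin> B" and inj: "inj_on ev B"
  shows "independent B"
proof
  assume "dependent B"
  then obtain t r v where t: "finite t" "t \<subseteq> B" "(\<Sum>w\<in>t. r w \<cdot> w) = 0" and v: "v \<in> t" "r v \<noteq> 0"
    unfolding dependent_explicit by blast
  have "ev v \<notin> ev ` (t - {v})"
    using inj t(2) v(1) by (auto dest!: inj_onD[of ev B])
  then obtain P where P: "Vector_Spaces.linear scale scale P"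
    "\<And>u. K u = ev v \<cdot> u \<Longrightarrow> P u = u" "\<And>s u. s \<in> ev ` (t - {v}) \<Longrightarrow> K u = s \<cdot> u \<Longrightarrow> P u = 0"
    using eigenprojection[of "ev ` (t - {v})" "ev v"] t(1) by blast
  interpret P: Vector_Spaces.linear scale scale P by (rule P(1))
  have "P w = (if w = v then v else 0)" if "w \<in> t" for w
    using that P(2)[of w] P(3)[of "ev w" w] eig t(2) by auto
  then have "(\<Sum>w\<in>t. r w \<cdot> P w) = (\<Sum>w\<in>t. if w = v then r v \<cdot> v else 0)"
    by (intro sum.cong) auto
  also have "\<dots> = r v \<cdot> v" using t(1) v(1) by simp
  finally have "r v \<cdot> v = P (\<Sum>w\<in>t. r w \<cdot> w)"
    by (simp add: P.sum P.scale)
  then have "r v \<cdot> v = 0" by (simp add: t(3) P.zero)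
  then show False using v t(2) nz by auto
qed

end

section \<open>Weights and strings of the module\<close>

lemma is_endo_iff:
  "is_endo U T \<longleftrightarrow> vector_space (smult U) \<and> (\<forall>u v. T (u + v) = T u + T v) \<and>
    (\<forall>c u. T (smult U c u) = smult U c (T u))"
  by (auto simp: is_endo_def Vector_Spaces.linear_iff)

lemma is_endo_add: "is_endo U T \<Longrightarrow> T (u + v) = T u + T v"
  and is_endo_scale: "is_endo U T \<Longrightarrow> T (smult U c u) = smult U c (T u)"
  by (simp_all add: is_endo_iff)

lemma is_endo_zero: "is_endo U T \<Longrightarrow> T 0 = 0"
  unfolding is_endo_def module_hom_iff_linear[symmetric] by (rule module_hom.zero)

lemma A_series_ratio:
  assumes "z i \<noteq> 0" "z (Suc i) = t * z i"
  shows "A_series \<tau> U i z m = A_series \<tau> U i (\<lambda>j. if j = i then 1 else t) m"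
proof -
  have "(z (Suc i) - a * z i) / (z (Suc i) - b * z i) = (t - a) / (t - b)" for a b
    using assms(1) unfolding assms(2) by (simp flip: left_diff_distrib)
  then show ?thesis by (simp add: A_series_def Let_def fun_eq_iff)
qed

locale finite_type_I_module = Uq_sl_module q M U + generic_parameter \<tau>
  for q :: complex and M :: nat and U :: "('u::ab_group_add) Uq_rep" and \<tau> :: complex +
  fixes i :: nat
  assumes q_exp: "q = exp \<tau>"
    and finite_dim: "finite_dim_rep U"
    and type_I: "type_I q M U"
    and i: "i \<in> {1..<M}"
begin

sublocale vs: vector_space "smult U" by (rule vector_space)

abbreviation scl :: "complex \<Rightarrow> 'u \<Rightarrow> 'u" (infixr "\<cdot>" 75) where "c \<cdot> u \<equiv> smult U c u"

abbreviation "E \<equiv> opE U i"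
abbreviation "F \<equiv> opF U i"
abbreviation "K \<equiv> opK U i"

lemma linear_op:
  assumes "j \<in> {1..<M}"
  shows "Vector_Spaces.linear (smult U) (smult U) (opE U j)"
    "Vector_Spaces.linear (smult U) (smult U) (opF U j)"
    "Vector_Spaces.linear (smult U) (smult U) (opK U j)"
    "Vector_Spaces.linear (smult U) (smult U) (opKinv U j)"
  using endo[OF assms] by (auto simp: is_endo_def)

sublocale K: linear_operator "smult U" K
  by (intro linear_operator.intro linear_operator_axioms.intro vector_space linear_op(3)[OF i])

lemma q_nonzero [simp]: "q \<noteq> 0" by (simp add: q_exp)

lemmas q_powi_eq_iff = powi_eq_iff[folded q_exp]

lemma K_E_commute:
  assumes j: "j \<in> {1..<M}" and u: "opK U j u = c \<cdot> u"
  shows "opK U j (E u) = (q powi cartanA j i * c) \<cdot> E u"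
proof -
  interpret E: Vector_Spaces.linear "smult U" "smult U" E by (rule linear_op[OF i])
  have "opK U j (E u) = opK U j (E (opKinv U j (opK U j u)))"
    using K_inverse[OF j] by simp
  also have "\<dots> = q powi cartanA j i \<cdot> E (c \<cdot> u)"
    unfolding K_E[OF j i] u ..
  finally show ?thesis by (simp add: E.scale)
qed

lemma K_F_commute:
  assumes j: "j \<in> {1..<M}" and u: "opK U j u = c \<cdot> u"
  shows "opK U j (F u) = (q powi (- cartanA j i) * c) \<cdot> F u"
proof -
  interpret F: Vector_Spaces.linear "smult U" "smult U" F by (rule linear_op[OF i])
  have "opK U j (F u) = opK U j (F (opKinv U j (opK U j u)))"
    using K_inverse[OF j] by simp
  also have "\<dots> = q powi (- cartanA j i) \<cdot> F (c \<cdot> u)"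
    unfolding K_F[OF j i] u ..
  finally show ?thesis by (simp add: F.scale)
qed

definition eig :: "int \<Rightarrow> 'u set" where
  "eig m = {u. K u = q powi m \<cdot> u}"

lemma eig_add: "u \<in> eig m \<Longrightarrow> v \<in> eig m \<Longrightarrow> u + v \<in> eig m"
  by (simp add: eig_def K.K.add vs.scale_right_distrib)

lemma eig_scale: "u \<in> eig m \<Longrightarrow> c \<cdot> u \<in> eig m"
  by (simp add: eig_def K.K.scale mult.commute)

lemma eig_E: "u \<in> eig m \<Longrightarrow> E u \<in> eig (m + 2)"
  using K_E_commute[OF i] by (simp add: eig_def cartanA_def power_int_add mult.commute)

lemma eig_F: "u \<in> eig m \<Longrightarrow> F u \<in> eig (m - 2)"
  using K_F_commute[OF i, of u "q powi m"] power_int_add[of q "-2" m]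
  by (simp add: eig_def cartanA_def)

lemma eig_commutator:
  assumes u: "u \<in> eig m"
  shows "E (F u) = F (E u) + qnum \<tau> (of_int m) \<cdot> u"
proof -
  interpret Ki: Vector_Spaces.linear "smult U" "smult U" "opKinv U i" by (rule linear_op[OF i])
  have Ku: "K u = q powi m \<cdot> u" using u by (simp add: eig_def)
  have "opKinv U i (K u) = u" using K_inverse[OF i] by blast
  then have "q powi m \<cdot> opKinv U i u = u" unfolding Ku Ki.scale .
  then have "q powi (- m) \<cdot> u = q powi (- m) \<cdot> q powi m \<cdot> opKinv U i u" by simp
  then have Kiu: "opKinv U i u = q powi (- m) \<cdot> u"
    by (simp add: power_int_minus)
  have "E (F u) - F (E u) = (1 / (q - inverse q)) \<cdot> (K u - opKinv U i u)"
    using E_F[OF i i] by simp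
  also have "\<dots> = ((q powi m - q powi (- m)) / (q - inverse q)) \<cdot> u"
    unfolding Ku Kiu by (simp add: vs.scale_left_diff_distrib[symmetric])
  also have "(q powi m - q powi (- m)) / (q - inverse q) = qnum \<tau> (of_int m)"
    using qpow_of_int[of \<tau> m] qpow_of_int[of \<tau> "- m"] qpow_of_int[of \<tau> 1] qpow_of_int[of \<tau> "-1"]
    by (simp add: qnum_def q_exp power_int_minus)
  finally show ?thesis by (simp add: diff_eq_eq add.commute)
qed

lemma wt_space_subset_eig: "wt_space q M U \<mu> \<subseteq> eig (hpair \<mu> i)"
  using i by (auto simp: wt_space_def eig_def)

lemma eig_unique:
  assumes "u \<in> eig m" "u \<in> eig n" "u \<noteq> 0"
  shows "m = n"
proof -
  have "q powi m \<cdot> u = q powi n \<cdot> u" using assms by (simp add: eig_def)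
  then show ?thesis using assms(3) by (simp add: q_powi_eq_iff)
qed

lemma span_wt_spaces: "vs.span (\<Union>\<mu>. wt_space q M U \<mu>) = UNIV"
  using type_I by (simp add: type_I_def)

text \<open>
  As \<open>q\<close> is not a root of unity, different weights are different eigenvalues of \<open>K\<close>, and eigenvectors for
  different eigenvalues are independent, so that there are only finitely many weights.
\<close>

lemma eig_bounded: "\<exists>N::nat. \<forall>m u. u \<in> eig m \<longrightarrow> \<bar>m\<bar> > int N \<longrightarrow> u = 0"
proof -
  define X where "X = {m. \<exists>u\<in>eig m. u \<noteq> 0}"
  define b where "b m = (SOME u. u \<in> eig m \<and> u \<noteq> 0)" for m
  have b: "b m \<in> eig m" "b m \<noteq> 0" if "m \<in> X" for m
    using someI_ex[of "\<lambda>u. u \<in> eig m \<and> u \<noteq> 0"] that by (auto simp: X_def b_def)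
  have inj: "inj_on b X"
    using b eig_unique by (metis inj_onI)
  define ev where "ev u = q powi (the_inv_into X b u)" for u
  have ev: "ev (b m) = q powi m" if "m \<in> X" for m
    using that by (simp add: ev_def the_inv_into_f_f[OF inj])
  have "vs.independent (b ` X)"
  proof (rule K.eigenvectors_independent[where ev = ev])
    show "K v = ev v \<cdot> v" if "v \<in> b ` X" for v
      using that b ev by (auto simp: eig_def)
    show "0 \<notin> b ` X" using b by force
    show "inj_on ev (b ` X)"
      using ev q_powi_eq_iff by (auto simp: inj_on_def)
  qed
  moreover obtain B where "finite B" "vs.span B = UNIV"
    using finite_dim by (auto simp: finite_dim_rep_def)
  ultimately have "finite (b ` X)"
    using vs.independent_span_bound[of B "b ` X"] by simp
  then have "finite X" using inj by (rule finite_imageD)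
  define N where "N = nat (Max (abs ` X))"
  have "u = 0" if "u \<in> eig m" "\<bar>m\<bar> > int N" for m u
  proof (rule ccontr)
    assume "u \<noteq> 0"
    then have "m \<in> X" using that by (auto simp: X_def)
    then have "\<bar>m\<bar> \<le> Max (abs ` X)" using \<open>finite X\<close> by (intro Max_ge) auto
    then show False using that(2) unfolding N_def by linarith
  qed
  then show ?thesis by blast
qed

definition weight_bound :: nat where
  "weight_bound = (SOME N. \<forall>m u. u \<in> eig m \<longrightarrow> \<bar>m\<bar> > int N \<longrightarrow> u = 0)"

lemma weight_bound: "u \<in> eig m \<Longrightarrow> \<bar>m\<bar> > int weight_bound \<Longrightarrow> u = 0"
  using someI_ex[OF eig_bounded] unfolding weight_bound_def by blast

sublocale sl2: weighted_sl2 "smult U" \<tau> E F eig weight_bound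
  by (intro weighted_sl2.intro weighted_sl2_axioms.intro vector_space generic_parameter_axioms
      linear_op[OF i] eig_add eig_scale eig_E eig_F eig_commutator weight_bound)

definition root_shift :: "(nat \<Rightarrow> int) \<Rightarrow> int \<Rightarrow> nat \<Rightarrow> int" where
  "root_shift \<mu> n j = \<mu> j + n * (if j = i then 1 else if j = Suc i then - 1 else 0)"

lemma hpair_root_shift: "hpair (root_shift \<mu> n) j = hpair \<mu> j + n * cartanA j i"
  by (auto simp: hpair_def root_shift_def cartanA_def algebra_simps)

text \<open>
  The weight spaces along the line \<open>\<mu> + \<int> \<alpha>\<^sub>i\<close>, indexed by the pairing of the weight with \<open>h\<^sub>i\<close>. Working with
  these instead of the larger eigenspaces of \<open>K\<close> yields strings whose highest weight vectors are
  weight vectors for all the \<open>K\<^sub>j\<close>, as the characterization of the dynamical Weyl group demands.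
\<close>

definition root_line :: "(nat \<Rightarrow> int) \<Rightarrow> int \<Rightarrow> 'u set" where
  "root_line \<mu> m = {u. \<exists>n. m = hpair \<mu> i + 2 * n \<and> u \<in> wt_space q M U (root_shift \<mu> n)}"

lemma wt_add: "u \<in> wt_space q M U \<mu> \<Longrightarrow> v \<in> wt_space q M U \<mu> \<Longrightarrow> u + v \<in> wt_space q M U \<mu>"
proof -
  assume *: "u \<in> wt_space q M U \<mu>" "v \<in> wt_space q M U \<mu>"
  have "opK U j (u + v) = q powi hpair \<mu> j \<cdot> (u + v)" if j: "j \<in> {1..<M}" for j
  proof -
    interpret Kj: Vector_Spaces.linear "smult U" "smult U" "opK U j" by (rule linear_op[OF j])
    show ?thesis using * j by (simp add: wt_space_def Kj.add vs.scale_right_distrib)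
  qed
  then show ?thesis by (simp add: wt_space_def)
qed

lemma wt_scale: "u \<in> wt_space q M U \<mu> \<Longrightarrow> c \<cdot> u \<in> wt_space q M U \<mu>"
proof -
  assume *: "u \<in> wt_space q M U \<mu>"
  have "opK U j (c \<cdot> u) = q powi hpair \<mu> j \<cdot> c \<cdot> u" if j: "j \<in> {1..<M}" for j
  proof -
    interpret Kj: Vector_Spaces.linear "smult U" "smult U" "opK U j" by (rule linear_op[OF j])
    show ?thesis using * j by (simp add: wt_space_def Kj.scale mult.commute)
  qed
  then show ?thesis by (simp add: wt_space_def)
qed

lemma wt_E:
  assumes "u \<in> wt_space q M U (root_shift \<mu> n)"
  shows "E u \<in> wt_space q M U (root_shift \<mu> (n + 1))"
proof -
  have "opK U j (E u) = q powi hpair (root_shift \<mu> (n + 1)) j \<cdot> E u" if j: "j \<in> {1..<M}" for j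
  proof -
    have "hpair (root_shift \<mu> (n + 1)) j = cartanA j i + hpair (root_shift \<mu> n) j"
      by (simp add: hpair_root_shift distrib_right)
    then have "q powi hpair (root_shift \<mu> (n + 1)) j = q powi cartanA j i * q powi hpair (root_shift \<mu> n) j"
      by (simp only: power_int_add[OF disjI1[OF q_nonzero]])
    then show ?thesis
      using K_E_commute[OF j, of u "q powi hpair (root_shift \<mu> n) j"] assms j
      by (simp add: wt_space_def)
  qed
  then show ?thesis by (simp add: wt_space_def)
qed

lemma wt_F:
  assumes "u \<in> wt_space q M U (root_shift \<mu> n)"
  shows "F u \<in> wt_space q M U (root_shift \<mu> (n - 1))"
proof -
  have "opK U j (F u) = q powi hpair (root_shift \<mu> (n - 1)) j \<cdot> F u" if j: "j \<in> {1..<M}" for j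
  proof -
    have "hpair (root_shift \<mu> (n - 1)) j = - cartanA j i + hpair (root_shift \<mu> n) j"
      by (simp add: hpair_root_shift left_diff_distrib)
    then have "q powi hpair (root_shift \<mu> (n - 1)) j = q powi (- cartanA j i) * q powi hpair (root_shift \<mu> n) j"
      by (simp only: power_int_add[OF disjI1[OF q_nonzero]])
    then show ?thesis
      using K_F_commute[OF j, of u "q powi hpair (root_shift \<mu> n) j"] assms j
      by (simp add: wt_space_def)
  qed
  then show ?thesis by (simp add: wt_space_def)
qed

lemma root_line_subset_eig: "root_line \<mu> m \<subseteq> eig m"
proof
  fix u assume "u \<in> root_line \<mu> m"
  then obtain n where n: "m = hpair \<mu> i + 2 * n" "u \<in> wt_space q M U (root_shift \<mu> n)"
    by (auto simp: root_line_def)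
  then have "u \<in> eig (hpair (root_shift \<mu> n) i)" using wt_space_subset_eig by blast
  then show "u \<in> eig m" by (simp add: hpair_root_shift n(1) cartanA_def mult.commute)
qed

lemma root_line_sl2: "weighted_sl2 (smult U) \<tau> E F (root_line \<mu>) weight_bound"
proof (intro weighted_sl2.intro weighted_sl2_axioms.intro vector_space generic_parameter_axioms linear_op[OF i])
  fix u m assume u: "u \<in> root_line \<mu> m"
  then have eig: "u \<in> eig m" using root_line_subset_eig by blast
  obtain n where n: "m = hpair \<mu> i + 2 * n" "u \<in> wt_space q M U (root_shift \<mu> n)"
    using u by (auto simp: root_line_def)
  show "E u \<in> root_line \<mu> (m + 2)"
    unfolding root_line_def using n wt_E by (intro CollectI exI[of _ "n + 1"]) auto
  show "F u \<in> root_line \<mu> (m - 2)"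
    unfolding root_line_def using n wt_F by (intro CollectI exI[of _ "n - 1"]) auto
  show "E (F u) = F (E u) + qnum \<tau> (of_int m) \<cdot> u" using eig by (rule eig_commutator)
  show "int weight_bound < \<bar>m\<bar> \<Longrightarrow> u = 0" using eig by (rule weight_bound)
  show "c \<cdot> u \<in> root_line \<mu> m" for c
    using n wt_scale by (auto simp: root_line_def)
  show "u + v \<in> root_line \<mu> m" if "v \<in> root_line \<mu> m" for v
    using n that wt_add by (auto simp: root_line_def)
qed

definition strings :: "'u set" where
  "strings = {divF \<tau> U i k v | k l v \<nu>.
     v \<in> wt_space q M U \<nu> \<and> E v = 0 \<and> K v = q ^ l \<cdot> v \<and> k \<le> l}"

text \<open>
  The decomposition is carried out along every root line separately; a string vector there differs from
  \<open>F\<^bsup>(k)\<^esup> v\<close> by the nonzero factor \<open>[k]!\<close>.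
\<close>

lemma span_strings: "vs.span strings = UNIV"
proof -
  have "wt_space q M U \<mu> \<subseteq> vs.span strings" for \<mu>
  proof
    fix u assume u: "u \<in> wt_space q M U \<mu>"
    interpret line: weighted_sl2 "smult U" \<tau> E F "root_line \<mu>" weight_bound by (rule root_line_sl2)
    have "u \<in> root_line \<mu> (hpair \<mu> i)"
      using u by (auto simp: root_line_def wt_space_def hpair_root_shift intro!: exI[of _ 0])
    then have "u \<in> vs.span line.string_vectors"
      by (rule line.weight_vector_in_strings)
    moreover have "line.string_vectors \<subseteq> vs.span strings"
    proof
      fix w assume "w \<in> line.string_vectors"
      then obtain k l v where w: "w = (F ^^ k) v" "v \<in> root_line \<mu> (int l)" "E v = 0" "k \<le> l"
        by (auto simp: line.string_vectors_def)
      then obtain \<nu> where "v \<in> wt_space q M U \<nu>" by (auto simp: root_line_def)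
      moreover have "K v = q ^ l \<cdot> v"
        using subsetD[OF root_line_subset_eig w(2)] by (simp add: eig_def)
      ultimately have "divF \<tau> U i k v \<in> strings"
        using w by (auto simp: strings_def)
      moreover have "w = qfact \<tau> k \<cdot> divF \<tau> U i k v"
        by (simp add: divF_def w(1) qfact_nonzero)
      ultimately show "w \<in> vs.span strings"
        by (simp add: vs.span_scale vs.span_base)
    qed
    ultimately show "u \<in> vs.span strings"
      using vs.span_minimal[OF _ vs.subspace_span] by blast
  qed
  then have "(\<Union>\<mu>. wt_space q M U \<mu>) \<subseteq> vs.span strings" by blast
  from vs.span_minimal[OF this vs.subspace_span] show ?thesis
    unfolding span_wt_spaces by auto
qed

section \<open>Existence and uniqueness of the operators\<close>

lemma endo_eq_on_spanning_set:
  assumes "is_endo U S" "is_endo U T" "\<And>u. u \<in> B \<Longrightarrow> S u = T u" "vs.span B = UNIV"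
  shows "S = T"
proof -
  have "vs.subspace {u. S u = T u}"
    unfolding vs.subspace_def mem_Collect_eq
    by (simp only: is_endo_zero[OF assms(1)] is_endo_zero[OF assms(2)] is_endo_add[OF assms(1)]
        is_endo_add[OF assms(2)] is_endo_scale[OF assms(1)] is_endo_scale[OF assms(2)] simp_thms) simp
  moreover have "B \<subseteq> {u. S u = T u}" using assms(3) by blast
  ultimately have "vs.span B \<subseteq> {u. S u = T u}" by (rule vs.span_minimal[rotated])
  then show ?thesis unfolding assms(4) by (intro ext) blast
qed

text \<open>
  Apply \<open>T m\<close> after the projection of \<open>U\<close> to the eigenspace of weight \<open>m\<close>, and sum over the finitely
  many weights.
\<close>

lemma glue_endomorphisms:
  assumes T: "\<And>m. is_endo U (T m)"
  shows "\<exists>S. is_endo U S \<and> (\<forall>m. \<forall>u\<in>eig m. S u = T m u)"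
proof -
  define W where "W = {- int weight_bound..int weight_bound}"
  have "\<forall>m. \<exists>P. is_endo U P \<and> (\<forall>u\<in>eig m. P u = u) \<and> (\<forall>n\<in>W - {m}. \<forall>u\<in>eig n. P u = 0)"
  proof
    fix m
    have notin: "q powi m \<notin> (\<lambda>n. q powi n) ` (W - {m})"
      by (auto simp: q_powi_eq_iff)
    have fin: "finite ((\<lambda>n. q powi n) ` (W - {m}))" by (simp add: W_def)
    obtain P where "Vector_Spaces.linear (smult U) (smult U) P"
      "\<forall>u. K u = q powi m \<cdot> u \<longrightarrow> P u = u"
      "\<forall>s\<in>(\<lambda>n. q powi n) ` (W - {m}). \<forall>u. K u = s \<cdot> u \<longrightarrow> P u = 0"
      using K.eigenprojection[OF fin notin] by (elim exE conjE)
    then show "\<exists>P. is_endo U P \<and> (\<forall>u\<in>eig m. P u = u) \<and> (\<forall>n\<in>W - {m}. \<forall>u\<in>eig n. P u = 0)"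
      unfolding is_endo_def eig_def by (intro exI[of _ P]) simp
  qed
  from choice[OF this] obtain P where "\<forall>m. is_endo U (P m) \<and> (\<forall>u\<in>eig m. P m u = u) \<and>
    (\<forall>n\<in>W - {m}. \<forall>u\<in>eig n. P m u = 0)" ..
  then have P: "is_endo U (P m)" "u \<in> eig m \<Longrightarrow> P m u = u"
    "n \<in> W - {m} \<Longrightarrow> u \<in> eig n \<Longrightarrow> P m u = 0" for m n u
    by blast+
  define S where "S u = (\<Sum>m\<in>W. T m (P m u))" for u
  have S_endo: "is_endo U S"
    unfolding is_endo_iff S_def is_endo_add[OF T] is_endo_add[OF P(1)] is_endo_scale[OF T]
      is_endo_scale[OF P(1)] sum.distrib vs.scale_sum_right
    by (simp add: vector_space)
  have "S u = T m u" if u: "u \<in> eig m" for m u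
  proof (cases "m \<in> W")
    case True
    have "S u = (\<Sum>n\<in>W. if n = m then T m u else 0)"
      unfolding S_def
    proof (rule sum.cong[OF refl])
      fix n assume "n \<in> W"
      show "T n (P n u) = (if n = m then T m u else 0)"
      proof (cases "n = m")
        case True
        then show ?thesis using P(2)[OF u] by simp
      next
        case False
        then have "P n u = 0" using P(3)[OF _ u, of n] True by blast
        then show ?thesis using False is_endo_zero[OF T] by simp
      qed
    qed
    then show ?thesis using True by (simp add: W_def)
  next
    case False
    then have "u = 0" using weight_bound[OF u] by (simp add: W_def abs_le_iff not_le[symmetric]) linarith
    moreover have "S 0 = 0" "T m 0 = 0"
      using is_endo_zero[OF T] is_endo_zero[OF S_endo] by blast+
    ultimately show ?thesis by (simp only:)
  qed
  then show ?thesis using S_endo by (intro exI[of _ S] conjI allI ballI)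
qed

text \<open>
  On weight vectors this is nilpotency of \<open>F\<close>; the uniform exponent extends it to their span. It truncates
  the series at an index that does not depend on the vector, which makes the series linear.
\<close>

lemma F_pow_eq_0:
  assumes "n > weight_bound"
  shows "(F ^^ n) u = 0"
proof -
  have "is_endo U (F ^^ n)" "is_endo U (\<lambda>_. 0)"
    by (auto simp: is_endo_iff vector_space sl2.F_pow_add sl2.F_pow_scale)
  moreover have "(F ^^ n) v = 0" if v: "v \<in> (\<Union>\<mu>. wt_space q M U \<mu>)" for v
  proof -
    obtain \<mu> where "v \<in> wt_space q M U \<mu>" using v by blast
    from sl2.F_nilpotent[OF subsetD[OF wt_space_subset_eig this] assms] show ?thesis .
  qed
  ultimately have "F ^^ n = (\<lambda>_. 0)"
    using span_wt_spaces by (intro endo_eq_on_spanning_set)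
  then show ?thesis by simp
qed

lemma A_series_eq_sum:
  "A_series \<tau> U i z m u = (\<Sum>j\<le>weight_bound.
     ((- q) ^ j * ((z (Suc i) - q powi \<bar>m\<bar> * z i) / (z (Suc i) - q powi (2 * int j + \<bar>m\<bar>) * z i))) \<cdot>
       divE \<tau> U i (j + nat (- m)) (divF \<tau> U i (j + nat m) u))"
proof -
  have zero: "divE \<tau> U i (j + nat (- m)) (divF \<tau> U i (j + nat m) u) = 0" if "weight_bound < j" for j
    using F_pow_eq_0[of "j + nat m" u] that by (simp add: divE_def divF_def)
  have *: "{j. c j \<cdot> divE \<tau> U i (j + nat (- m)) (divF \<tau> U i (j + nat m) u) \<noteq> 0} \<subseteq> {..weight_bound}"
    for c :: "nat \<Rightarrow> complex"
  proof
    fix j assume "j \<in> {j. c j \<cdot> divE \<tau> U i (j + nat (- m)) (divF \<tau> U i (j + nat m) u) \<noteq> 0}"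
    then show "j \<in> {..weight_bound}" using zero[of j] by (cases "weight_bound < j") simp_all
  qed
  show ?thesis
    unfolding A_series_def Let_def q_exp[symmetric]
    by (rule Sum_any.expand_superset[OF finite_atMost *])
qed

lemma A_series_endo: "is_endo U (A_series \<tau> U i z m)"
  unfolding is_endo_iff A_series_eq_sum divE_def divF_def
  by (simp add: vector_space sl2.F_pow_add sl2.F_pow_scale sl2.E_pow_add sl2.E_pow_scale
      vs.scale_right_distrib sum.distrib vs.scale_sum_right mult_ac)

lemma A_op_eq_series:
  assumes "u \<in> wt_space q M U \<mu>"
  shows "A_op \<tau> M U i z u = A_series \<tau> U i z (hpair \<mu> i) u"
proof -
  let ?P = "\<lambda>T. is_endo U T \<and>
    (\<forall>\<mu>. \<forall>u \<in> wt_space (exp \<tau>) M U \<mu>. T u = A_series \<tau> U i z (hpair \<mu> i) u)"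
  have "\<exists>!T. ?P T"
  proof (rule ex_ex1I)
    obtain T where T: "is_endo U T" "\<And>m u. u \<in> eig m \<Longrightarrow> T u = A_series \<tau> U i z m u"
      using glue_endomorphisms[of "A_series \<tau> U i z"] A_series_endo by blast
    then have "?P T"
      using wt_space_subset_eig unfolding q_exp[symmetric] by blast
    then show "\<exists>T. ?P T" by (rule exI[where P = ?P])
    show "S = T" if "?P S" "?P T" for S T
      using that by (intro endo_eq_on_spanning_set[OF _ _ _ span_wt_spaces]) (auto simp: q_exp[symmetric])
  qed
  from theI'[OF this] show ?thesis
    using assms unfolding A_op_def q_exp[symmetric] by blast
qed

lemma A_series_on_string:
  assumes v: "v \<in> eig (int l)" "E v = 0" and k: "k \<le> l" and reg: "regular weight_bound x"
  shows "A_series \<tau> U i (\<lambda>j. if j = i then 1 else qpow \<tau> (- 2 * x)) (int l - 2 * int k) (divF \<tau> U i k v) =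
    (normalization (int l - 2 * int k) x * weyl_coefficient l k x) \<cdot> divF \<tau> U i (l - k) v"
proof (cases "v = 0")
  case True
  have "divF \<tau> U i n 0 = 0" "divE \<tau> U i n 0 = 0" for n by (simp_all add: divF_def divE_def)
  then show ?thesis by (simp add: A_series_eq_sum True)
next
  case False
  then have l: "l \<le> weight_bound" using weight_bound[OF v(1)] by force
  define m p K where "m = int l - 2 * int k" and "p = nat \<bar>m\<bar>" and "K = min k (l - k)"
  define t where "t = qpow \<tau> (- 2 * x)"
  define c where "c j = (- q) ^ j * ((t - q ^ p) / (t - q ^ (2 * j + p)))" for j
  define d where "d j = qfact \<tau> (j + p + K) / (qfact \<tau> j * qfact \<tau> (j + p) * qfact \<tau> (K - j))" for j
  have KN: "K \<le> weight_bound" using l k by (simp add: K_def)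
  have "2 * int j + \<bar>m\<bar> = int (2 * j + p)" "\<bar>m\<bar> = int p" for j by (simp_all add: p_def)
  then have pw: "q powi (2 * int j + \<bar>m\<bar>) = q ^ (2 * j + p)" "q powi \<bar>m\<bar> = q ^ p" for j
    by (simp_all only: power_int_of_nat)
  have "A_series \<tau> U i (\<lambda>j. if j = i then 1 else t) m (divF \<tau> U i k v) =
      (\<Sum>j\<le>weight_bound. c j \<cdot> (if j \<le> K then d j else 0) \<cdot> divF \<tau> U i (l - k) v)"
    unfolding A_series_eq_sum
  proof (rule sum.cong[OF refl])
    fix j
    have "divE \<tau> U i (j + nat (- m)) (divF \<tau> U i (j + nat m) (divF \<tau> U i k v)) =
        (if j \<le> K then d j else 0) \<cdot> divF \<tau> U i (l - k) v"
      unfolding divE_def divF_def d_def p_def K_def m_def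
      by (rule sl2.divided_powers_on_string[OF v k])
    then show "((- q) ^ j * (((if Suc i = i then 1 else t) - q powi \<bar>m\<bar> * (if i = i then 1 else t)) /
          ((if Suc i = i then 1 else t) - q powi (2 * int j + \<bar>m\<bar>) * (if i = i then 1 else t)))) \<cdot>
        divE \<tau> U i (j + nat (- m)) (divF \<tau> U i (j + nat m) (divF \<tau> U i k v)) =
      c j \<cdot> (if j \<le> K then d j else 0) \<cdot> divF \<tau> U i (l - k) v"
      by (simp add: c_def pw)
  qed
  also have "\<dots> = (\<Sum>j\<le>K. c j * d j) \<cdot> divF \<tau> U i (l - k) v"
    unfolding vs.scale_sum_left
    by (rule sum.mono_neutral_cong_right) (use KN in auto)
  also have "(\<Sum>j\<le>K. c j * d j) = (-1) ^ K * (\<Prod>j=1..K. qnum \<tau> (x - of_nat j - of_nat p / 2) /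
      qnum \<tau> (x + of_nat j + of_nat p / 2))"
    unfolding c_def d_def t_def q_exp
  \<comment> \<open>The denominators that occur have \<open>2 j + p \<le> l\<close>, which the weight bound covers.\<close>
  proof (rule dynamical_sum)
    fix j assume "j \<le> K"
    then have "\<bar>int (2 * j + p)\<bar> \<le> int weight_bound"
      using l k by (auto simp: K_def p_def m_def)
    then have "qnum \<tau> (x + of_int (int (2 * j + p)) / 2) \<noteq> 0"
      using reg unfolding regular_def by blast
    then show "qnum \<tau> (x + of_nat j + of_nat p / 2) \<noteq> 0"
      by (simp add: add_divide_distrib add.assoc)
  qed
  also have "\<dots> = normalization m x * weyl_coefficient l k x"
    unfolding m_def K_def p_def by (rule normalized_weyl_coefficient[OF reg l k, symmetric])
  finally show ?thesis unfolding t_def m_def .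
qed

lemma divF_eig: "v \<in> eig m \<Longrightarrow> divF \<tau> U i k v \<in> eig (m - 2 * int k)"
  unfolding divF_def by (intro eig_scale sl2.F_pow_V)

text \<open>
  Existence of the dynamical Weyl group operator is proved by exhibiting it: on every eigenspace of \<open>K\<close> it
  is the series divided by the normalization. This is where the regularity of \<open>x\<close> enters.
\<close>

lemma dyn_weyl_eq_series:
  assumes u: "u \<in> eig m" and reg: "regular weight_bound x" and x: "hpair lam i = x"
  shows "normalization m x \<cdot> dyn_weyl \<tau> M U i lam u =
    A_series \<tau> U i (\<lambda>j. if j = i then 1 else qpow \<tau> (- 2 * x)) m u"
proof -
  define A where "A n = A_series \<tau> U i (\<lambda>j. if j = i then 1 else qpow \<tau> (- 2 * x)) n" for n
  let ?P = "\<lambda>T. is_endo U T \<and>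
    (\<forall>\<nu> l k v. v \<in> wt_space (exp \<tau>) M U \<nu> \<longrightarrow> E v = 0 \<longrightarrow> K v = exp \<tau> ^ l \<cdot> v \<longrightarrow> k \<le> l \<longrightarrow>
      T (divF \<tau> U i k v) = weyl_coefficient l k x \<cdot> divF \<tau> U i (l - k) v)"
  have "is_endo U (\<lambda>u. (1 / normalization n x) \<cdot> A n u)" for n
    using A_series_endo unfolding A_def is_endo_iff
    by (simp add: vs.scale_right_distrib mult_ac)
  then obtain T where T: "is_endo U T" "\<And>n u. u \<in> eig n \<Longrightarrow> T u = (1 / normalization n x) \<cdot> A n u"
    using glue_endomorphisms[of "\<lambda>n u. (1 / normalization n x) \<cdot> A n u"] by blast
  have PT: "?P T"
  proof (intro conjI allI impI)
    fix \<nu> l k v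
    assume v: "E v = 0" "K v = exp \<tau> ^ l \<cdot> v" and k: "k \<le> l"
    have ve: "v \<in> eig (int l)" using v(2) by (simp add: eig_def q_exp[symmetric])
    show "T (divF \<tau> U i k v) = weyl_coefficient l k x \<cdot> divF \<tau> U i (l - k) v"
    proof (cases "v = 0")
      case True
      have "divF \<tau> U i n 0 = 0" for n by (simp add: divF_def)
      moreover have "T 0 = 0" using T(1) by (rule is_endo_zero)
      ultimately show ?thesis by (simp add: True)
    next
      case False
      then have "l \<le> weight_bound" using weight_bound[OF ve] by force
      then have "normalization (int l - 2 * int k) x \<noteq> 0"
        using k by (intro normalization_nonzero[OF reg]) simp
      then show ?thesis
        unfolding T(2)[OF divF_eig[OF ve]] A_def A_series_on_string[OF ve v(1) k reg] by simp
    qed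
  qed (rule T(1))
  have "dyn_weyl \<tau> M U i lam = (THE T. ?P T)"
    unfolding dyn_weyl_def weyl_coefficient_def x ..
  also have "\<dots> = T"
  proof (rule the_equality[where P = ?P, OF PT])
    show "S = T" if S: "?P S" for S
    proof (rule endo_eq_on_spanning_set[OF _ _ _ span_strings])
      fix u assume "u \<in> strings"
      then obtain k l v \<nu> where u: "u = divF \<tau> U i k v" and v: "v \<in> wt_space (exp \<tau>) M U \<nu>"
        "E v = 0" "K v = exp \<tau> ^ l \<cdot> v" "k \<le> l"
        unfolding strings_def q_exp[symmetric] by blast
      have "S u = weyl_coefficient l k x \<cdot> divF \<tau> U i (l - k) v"
        unfolding u using S v by blast
      moreover have "T u = weyl_coefficient l k x \<cdot> divF \<tau> U i (l - k) v"
        unfolding u using PT v by blast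
      ultimately show "S u = T u" by simp
    qed (use S PT in blast)+
  qed
  finally have W: "dyn_weyl \<tau> M U i lam u = (1 / normalization m x) \<cdot> A m u"
    using T(2)[OF u] by simp
  show ?thesis
  proof (cases "u = 0")
    case True
    have "A m 0 = 0" unfolding A_def by (rule is_endo_zero[OF A_series_endo])
    then show ?thesis using W by (simp add: True A_def)
  next
    case False
    then have "normalization m x \<noteq> 0"
      using weight_bound[OF u] by (intro normalization_nonzero[OF reg]) force
    then show ?thesis using W by (simp add: A_def)
  qed
qed

lemma meromorphic_A_series:
  assumes "is_functional U \<phi>"
  shows "(\<lambda>x. \<phi> (A_series \<tau> U i (\<lambda>j. if j = i then 1 else qpow \<tau> (- 2 * x)) m u)) meromorphic_on UNIV"
proof -
  interpret \<phi>: Vector_Spaces.linear "smult U" "(*)" \<phi>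
    using assms by (simp add: is_functional_def)
  have "(\<lambda>x. qpow \<tau> (- 2 * x)) meromorphic_on UNIV"
    unfolding qpow_def by (intro analytic_on_imp_meromorphic_on analytic_intros)
  then show ?thesis
    unfolding A_series_eq_sum \<phi>.sum \<phi>.scale
    by (simp, intro meromorphic_intros)
qed

text \<open>
  Both operators depend on \<open>\<lambda>\<close> only through \<open>\<lambda>(h\<^sub>i)\<close>: as the series is homogeneous of degree \<open>0\<close> in \<open>z\<close>, it may
  be evaluated at \<open>z\<^sub>i = 1\<close>, \<open>z\<^sub>i\<^sub>+\<^sub>1 = q\<^bsup>-2\<lambda>(h\<^sub>i)\<^esup>\<close>. This also
  provides the meromorphic function that both sides are compared with.
\<close>

lemma meromorphic_eq_normalized_dyn_weyl:
  assumes c: "\<And>x. regular weight_bound x \<Longrightarrow> c x = normalization (hpair \<mu> i) x"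
  shows "meromorphic_eq_on U i (wt_space q M U \<mu>)
    (\<lambda>lam. A_op \<tau> M U i (\<lambda>j. qpow \<tau> (2 * lam j)))
    (\<lambda>lam u. c (hpair lam i) \<cdot> dyn_weyl \<tau> M U i lam u)"
proof -
  define H where "H x = A_series \<tau> U i (\<lambda>j. if j = i then 1 else qpow \<tau> (- 2 * x)) (hpair \<mu> i)" for x
  have A: "A_op \<tau> M U i (\<lambda>j. qpow \<tau> (2 * lam j)) u = H (hpair lam i) u"
    if "u \<in> wt_space q M U \<mu>" for lam u
  proof -
    have "qpow \<tau> (2 * lam (Suc i)) = qpow \<tau> (- 2 * hpair lam i) * qpow \<tau> (2 * lam i)"
      by (simp add: hpair_def qpow_add[symmetric] algebra_simps)
    then show ?thesis
      unfolding A_op_eq_series[OF that] H_def by (subst A_series_ratio) auto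
  qed
  have W: "c x \<cdot> dyn_weyl \<tau> M U i lam u = H x u"
    if reg: "regular weight_bound x" and x: "hpair lam i = x" and u: "u \<in> wt_space q M U \<mu>" for x lam u
  proof -
    have eig: "u \<in> eig (hpair \<mu> i)" using u wt_space_subset_eig by blast
    show ?thesis
      unfolding c[OF reg] H_def by (rule dyn_weyl_eq_series[OF eig reg x])
  qed
  show ?thesis
    unfolding meromorphic_eq_on_def
  proof (intro exI[of _ H] conjI ballI allI impI)
    show "(\<lambda>x. \<phi> (H x u)) meromorphic_on UNIV" if "is_functional U \<phi>" for u \<phi>
      unfolding H_def using that by (rule meromorphic_A_series)
    show "\<forall>\<^sub>\<approx>x. \<forall>lam. hpair lam i = x \<longrightarrow> (\<forall>u\<in>wt_space q M U \<mu>.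
        A_op \<tau> M U i (\<lambda>j. qpow \<tau> (2 * lam j)) u = H x u \<and>
        c (hpair lam i) \<cdot> dyn_weyl \<tau> M U i lam u = H x u)"
      using eventually_regular[of weight_bound] by (rule eventually_mono) (auto simp: A W)
  qed
qed

end

section \<open>Comparison of the operators\<close>

theorem proposition4p3:
  fixes q \<tau> :: complex and M i :: nat and U :: "('u::ab_group_add) Uq_rep"
    and \<mu> :: "nat \<Rightarrow> int"
  assumes "M \<ge> 2"
    and "q = exp \<tau>"
    and "\<forall>n::nat. n > 0 \<longrightarrow> q ^ n \<noteq> 1"
    and "Uq_sl_module q M U"
    and "finite_dim_rep U"
    and "type_I q M U"
    and "1 \<le> i" and "i \<le> M - 1"
    and "is_weight q M U \<mu>"
  shows "(hpair \<mu> i \<ge> 0 \<longrightarrow>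
      meromorphic_eq_on U i (wt_space q M U \<mu>)
        (\<lambda>lam. A_op \<tau> M U i (\<lambda>j. qpow \<tau> (2 * lam j)))
        (\<lambda>lam u. smult U (q powi (- hpair \<mu> i)) (dyn_weyl \<tau> M U i lam u))) \<and>
    (hpair \<mu> i \<le> 0 \<longrightarrow>
      meromorphic_eq_on U i (wt_space q M U \<mu>)
        (\<lambda>lam. A_op \<tau> M U i (\<lambda>j. qpow \<tau> (2 * lam j)))
        (\<lambda>lam u. smult U ((-1) powi hpair \<mu> i * q powi (- hpair \<mu> i) *
              (qnum \<tau> (hpair lam i - of_int (hpair \<mu> i) / 2) /
               qnum \<tau> (hpair lam i + of_int (hpair \<mu> i) / 2)))
            (dyn_weyl \<tau> M U i lam u)))"
proof -
  interpret finite_type_I_module q M U \<tau> i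
    using assms by (auto simp: finite_type_I_module_def finite_type_I_module_axioms_def
        generic_parameter_def)
  show ?thesis
  proof (intro conjI impI)
    assume "hpair \<mu> i \<ge> 0"
    then show "meromorphic_eq_on U i (wt_space q M U \<mu>)
        (\<lambda>lam. A_op \<tau> M U i (\<lambda>j. qpow \<tau> (2 * lam j)))
        (\<lambda>lam u. smult U (q powi (- hpair \<mu> i)) (dyn_weyl \<tau> M U i lam u))"
      by (intro meromorphic_eq_normalized_dyn_weyl) (simp add: normalization_def q_exp)
  next
    assume le: "hpair \<mu> i \<le> 0"
    define c where "c x = (-1) powi hpair \<mu> i * q powi (- hpair \<mu> i) *
      (qnum \<tau> (x - of_int (hpair \<mu> i) / 2) / qnum \<tau> (x + of_int (hpair \<mu> i) / 2))" for x
    have "c x = normalization (hpair \<mu> i) x" if "regular weight_bound x" for x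
    proof (cases "hpair \<mu> i = 0")
      case True
      have "qnum \<tau> x \<noteq> 0"
        using that by (auto simp: regular_def dest: spec[of _ 0])
      then show ?thesis by (simp add: c_def True normalization_def)
    next
      case False
      then show ?thesis using le by (simp add: c_def normalization_def q_exp)
    qed
    then have "meromorphic_eq_on U i (wt_space q M U \<mu>)
        (\<lambda>lam. A_op \<tau> M U i (\<lambda>j. qpow \<tau> (2 * lam j)))
        (\<lambda>lam u. smult U (c (hpair lam i)) (dyn_weyl \<tau> M U i lam u))"
      by (intro meromorphic_eq_normalized_dyn_weyl)
    then show "meromorphic_eq_on U i (wt_space q M U \<mu>)
        (\<lambda>lam. A_op \<tau> M U i (\<lambda>j. qpow \<tau> (2 * lam j)))
        (\<lambda>lam u. smult U ((-1) powi hpair \<mu> i * q powi (- hpair \<mu> i) *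
              (qnum \<tau> (hpair lam i - of_int (hpair \<mu> i) / 2) /
               qnum \<tau> (hpair lam i + of_int (hpair \<mu> i) / 2)))
            (dyn_weyl \<tau> M U i lam u))"
      unfolding c_def .
  qed
qed

end
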